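(* Let $E$ be a finite set with $|E|\ge2$, let $K\subseteq\mathbb R_+^E$ be a rational polyhedral cone, $P=K\cap[0,1]^E$, $c$ an objective vector with $\alpha=\max\{c^\top y:y\in P\}>0$, and $J\subseteq E$. Assume that linear optimization over $P$, with additional prescribed zero coordinates, is polynomial-time solvable. For fixed $\ell\ge 1$, membership of $J$ in $\mathcal B_\ell$ can be decided by solving at most $\ell^{|J|}$ linear programs; hence it is fixed-parameter tractable with parameter $|J|$ for every fixed $\ell$. Membership of $J$ in $\mathcal B_\infty$ can be decided by solving at most $|J|^{|J|}$ linear programs, and is therefore fixed-parameter tractable parameterized by $|J|$.
   Context: For $y\in\mathbb R_+^E$, $\operatorname{supp}(y)=\{e\in E:y_e>0\}$. For an integer $\ell\ge1$, $\mathcal B_\ell$ is the family of sets $J\subseteq E$ such that for all $z^1,\dots,z^\ell\in P$: $\left(\bigcap_{i=1}^\ell\operatorname{supp}(z^i)\right)\cap J=\emptyset$ implies $\sum_{i=1}^\ell c^\top z^i\le\alpha(\ell-1)$. $\mathcal B_\infty=\bigcap_{\ell\ge1}\mathcal B_\ell$. "Prescribed zero coordinates" means optimizing a linear function over $\{z\in P:z_e=0\ \forall e\in S\}$ for a given $S\subseteq E$; the linear programs in question may be over products of $\ell$ (resp. $|J|$) such sets. *)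

theory Defs
  imports "HOL-Analysis.Analysis" "HOL-Library.Log_Nat"
begin

section \<open>Cones, linear programs, and the families \<open>B\<^sub>l\<close>\<close>

text \<open>
  The space \<open>\<real>\<^sup>E\<close> for a finite \<open>E\<close> is the function space \<^term>\<open>E \<rightarrow>\<^sub>E (UNIV :: real set)\<close>.  The ground
  sets are finite sets of natural numbers, since ground elements have to be written into the input
  of algorithms; \<open>E\<close> itself is never fixed.
\<close>

definition dot :: "nat set \<Rightarrow> (nat \<Rightarrow> real) \<Rightarrow> (nat \<Rightarrow> real) \<Rightarrow> real" where
  "dot E w z = (\<Sum>e\<in>E. w e * z e)"

definition supp :: "nat set \<Rightarrow> (nat \<Rightarrow> real) \<Rightarrow> nat set" where
  "supp E y = {e \<in> E. y e > 0}"

definition rational_polyhedral_cone :: "nat set \<Rightarrow> (nat \<Rightarrow> real) set \<Rightarrow> bool" where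
  "rational_polyhedral_cone E K \<longleftrightarrow>
     (\<exists>A. finite A \<and> (\<forall>a\<in>A. \<forall>e\<in>E. a e \<in> \<rat>) \<and>
          K = {y \<in> E \<rightarrow>\<^sub>E UNIV. \<forall>a\<in>A. dot E a y \<le> 0})"

definition cone_instance :: "nat set \<Rightarrow> (nat \<Rightarrow> real) set \<Rightarrow> bool" where
  "cone_instance E K \<longleftrightarrow>
     finite E \<and> 2 \<le> card E \<and> K \<subseteq> E \<rightarrow>\<^sub>E {0..} \<and> rational_polyhedral_cone E K"

definition truncation :: "nat set \<Rightarrow> (nat \<Rightarrow> real) set \<Rightarrow> (nat \<Rightarrow> real) set" where
  "truncation E K = K \<inter> (E \<rightarrow>\<^sub>E {0..1})"

definition is_max :: "'a set \<Rightarrow> ('a \<Rightarrow> real) \<Rightarrow> real \<Rightarrow> bool" where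
  "is_max X f v \<longleftrightarrow> (\<exists>z\<in>X. f z = v) \<and> (\<forall>z\<in>X. f z \<le> v)"

definition zero_on :: "(nat \<Rightarrow> real) set \<Rightarrow> nat set \<Rightarrow> (nat \<Rightarrow> real) set" where
  "zero_on P S = {z \<in> P. \<forall>e\<in>S. z e = 0}"

definition B_fam ::
  "nat \<Rightarrow> nat set \<Rightarrow> (nat \<Rightarrow> real) set \<Rightarrow> (nat \<Rightarrow> real) \<Rightarrow> real \<Rightarrow> nat set set" where
  "B_fam l E P c \<alpha> =
     {J. J \<subseteq> E \<and>
         (\<forall>z :: nat \<Rightarrow> nat \<Rightarrow> real. (\<forall>i\<in>{1..l}. z i \<in> P) \<longrightarrow>
            (\<Inter>i\<in>{1..l}. supp E (z i)) \<inter> J = {} \<longrightarrow>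
            (\<Sum>i\<in>{1..l}. dot E c (z i)) \<le> \<alpha> * (real l - 1))}"

definition B_inf ::
  "nat set \<Rightarrow> (nat \<Rightarrow> real) set \<Rightarrow> (nat \<Rightarrow> real) \<Rightarrow> real \<Rightarrow> nat set set" where
  "B_inf E P c \<alpha> = (\<Inter>l\<in>{1..}. B_fam l E P c \<alpha>)"


section \<open>Programs and their running time\<close>

text \<open>
  Programs act on binary trees whose leaves may carry numbers.  Tree surgery, arithmetic and
  comparison of numbers are elementary.  An elementary step costs the total bit size of its input
  and output, so that on rational data the model is polynomially equivalent to Turing machines.
  The only number built into programs is 1.  Irrational numbers are admitted so that algorithms
  can also be run on a real objective vector; their size is a dummy value, and below running times
  are only considered for rational data.
\<close>

datatype val = Empty | Num real | Pair val val

definition rat_size :: "real \<Rightarrow> nat" where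
  "rat_size r =
     (if r \<in> \<rat> then (case quotient_of (THE q. of_rat q = r) of
        (a, b) \<Rightarrow> floorlog 2 (nat \<bar>a\<bar>) + floorlog 2 (nat b))
      else 0)"

primrec vsize :: "val \<Rightarrow> nat" where
  "vsize Empty = 1"
| "vsize (Num r) = 1 + rat_size r"
| "vsize (Pair x y) = 1 + vsize x + vsize y"

primrec rational_data :: "val \<Rightarrow> bool" where
  "rational_data Empty \<longleftrightarrow> True"
| "rational_data (Num r) \<longleftrightarrow> r \<in> \<rat>"
| "rational_data (Pair x y) \<longleftrightarrow> rational_data x \<and> rational_data y"

definition bool_code :: "bool \<Rightarrow> val" where
  "bool_code b = (if b then Num 1 else Empty)"

datatype opr = Ident | MkEmpty | MkOne | Left | Right | IsPair | IsNum
  | Plus | Minus | Times | Divide | Leq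

fun binary :: "(real \<Rightarrow> real \<Rightarrow> val) \<Rightarrow> val \<Rightarrow> val" where
  "binary f (Pair (Num a) (Num b)) = f a b"
| "binary f _ = Empty"

primrec apply_opr :: "opr \<Rightarrow> val \<Rightarrow> val" where
  "apply_opr Ident x = x"
| "apply_opr MkEmpty x = Empty"
| "apply_opr MkOne x = Num 1"
| "apply_opr Left x = (case x of Pair a b \<Rightarrow> a | _ \<Rightarrow> Empty)"
| "apply_opr Right x = (case x of Pair a b \<Rightarrow> b | _ \<Rightarrow> Empty)"
| "apply_opr IsPair x = bool_code (case x of Pair a b \<Rightarrow> True | _ \<Rightarrow> False)"
| "apply_opr IsNum x = bool_code (case x of Num r \<Rightarrow> True | _ \<Rightarrow> False)"
| "apply_opr Plus x = binary (\<lambda>a b. Num (a + b)) x"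
| "apply_opr Minus x = binary (\<lambda>a b. Num (a - b)) x"
| "apply_opr Times x = binary (\<lambda>a b. Num (a * b)) x"
| "apply_opr Divide x = binary (\<lambda>a b. Num (a / b)) x"
| "apply_opr Leq x = binary (\<lambda>a b. bool_code (a \<le> b)) x"

datatype prog =
    Op opr
  | Then prog prog
  | Fork prog prog
  | Cond prog prog prog
  | While prog prog
  | Query

text \<open>
  \<open>exec orc p x y t q\<close>: with oracle \<open>orc\<close>, program \<open>p\<close> on input \<open>x\<close> halts with output \<open>y\<close> after
  time \<open>t\<close> and \<open>q\<close> oracle queries.  A query outside the domain of \<open>orc\<close> blocks the execution.
  Copying the data for \<open>Fork\<close>, \<open>Cond\<close> and \<open>While\<close> is charged.
\<close>

inductive exec :: "(val \<Rightarrow> val \<Rightarrow> bool) \<Rightarrow> prog \<Rightarrow> val \<Rightarrow> val \<Rightarrow> nat \<Rightarrow> nat \<Rightarrow> bool"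
  for orc :: "val \<Rightarrow> val \<Rightarrow> bool" where
  Op: "y = apply_opr f x \<Longrightarrow> exec orc (Op f) x y (vsize x + vsize y) 0"
| Then: "exec orc p x y t q \<Longrightarrow> exec orc p' y z t' q' \<Longrightarrow>
    exec orc (Then p p') x z (t + t') (q + q')"
| Fork: "exec orc p x y t q \<Longrightarrow> exec orc p' x y' t' q' \<Longrightarrow>
    exec orc (Fork p p') x (Pair y y') (vsize x + t + t') (q + q')"
| Cond_true: "exec orc b x u s r \<Longrightarrow> u \<noteq> Empty \<Longrightarrow> exec orc p x y t q \<Longrightarrow>
    exec orc (Cond b p p') x y (vsize x + s + t) (r + q)"
| Cond_false: "exec orc b x Empty s r \<Longrightarrow> exec orc p' x y t q \<Longrightarrow>
    exec orc (Cond b p p') x y (vsize x + s + t) (r + q)"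
| While_stop: "exec orc b x Empty s r \<Longrightarrow> exec orc (While b p) x x (vsize x + s) r"
| While_step: "exec orc b x u s r \<Longrightarrow> u \<noteq> Empty \<Longrightarrow> exec orc p x y t q \<Longrightarrow>
    exec orc (While b p) y z t' q' \<Longrightarrow>
    exec orc (While b p) x z (vsize x + s + t + t') (r + q + q')"
| Query: "orc x y \<Longrightarrow> exec orc Query x y (vsize x + vsize y) 1"

definition runs :: "prog \<Rightarrow> val \<Rightarrow> val \<Rightarrow> nat \<Rightarrow> bool" where
  "runs p x y t \<longleftrightarrow> exec (\<lambda>_ _. False) p x y t 0"

lemma exec_deterministic:
  assumes "\<And>x y y'. orc x y \<Longrightarrow> orc x y' \<Longrightarrow> y = y'"
  shows "exec orc p x y t q \<Longrightarrow> exec orc p x y' t' q' \<Longrightarrow> y = y' \<and> t = t' \<and> q = q'"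
proof (induction arbitrary: y' t' q' rule: exec.induct)
  case (Op y f x)
  from Op.prems show ?case by cases (use Op.hyps in auto)
next
  case (Then p x y t q p' z t1 q1)
  from Then.prems show ?case by cases (use Then.IH in blast)
next
  case (Fork p x y t q p' y1 t1 q1)
  from Fork.prems show ?case by cases (use Fork.IH in blast)
next
  case (Cond_true b x u s r p y t q p')
  from Cond_true.prems show ?case by cases (use Cond_true.IH Cond_true.hyps in blast)+
next
  case (Cond_false b x s r p' y t q p)
  from Cond_false.prems show ?case by cases (use Cond_false.IH in blast)+
next
  case (While_stop b x s r p)
  from While_stop.prems show ?case by cases (use While_stop.IH in blast)+
next
  case (While_step b x u s r p y t q z t1 q1)
  from While_step.prems show ?case by cases (use While_step.IH While_step.hyps in blast)+
next
  case (Query x y)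
  from Query.prems show ?case by cases (use Query.hyps assms in auto)
qed

text \<open>A problem is given by its set of pairs of inputs and required outputs.\<close>

definition polytime :: "(val \<times> val) set \<Rightarrow> bool" where
  "polytime X \<longleftrightarrow>
     (\<exists>p C k. \<forall>(x, y)\<in>X. \<exists>t. runs p x y t \<and> t \<le> C * vsize x ^ k)"

definition computable :: "(nat \<Rightarrow> nat) \<Rightarrow> bool" where
  "computable f \<longleftrightarrow> (\<exists>p. \<forall>n. \<exists>t. runs p (Num (real n)) (Num (real (f n))) t)"

text \<open>
  A parameterized decision problem is given by its triples of input, parameter and correct answer.
\<close>

definition fixed_parameter_tractable :: "(val \<times> nat \<times> bool) set \<Rightarrow> bool" where
  "fixed_parameter_tractable X \<longleftrightarrow>
     (\<exists>p f k. computable f \<and>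
        (\<forall>(x, \<kappa>, b)\<in>X. \<exists>t. runs p x (bool_code b) t \<and> t \<le> f \<kappa> * vsize x ^ k))"


section \<open>The algorithmic problems\<close>

primrec list_code :: "val list \<Rightarrow> val" where
  "list_code [] = Empty"
| "list_code (x # xs) = Pair x (list_code xs)"

definition set_code :: "nat list \<Rightarrow> val" where
  "set_code js = list_code (map (\<lambda>e. Num (real e)) js)"

definition vec_code :: "nat list \<Rightarrow> (nat \<Rightarrow> real) \<Rightarrow> val" where
  "vec_code es w = list_code (map (\<lambda>e. Pair (Num (real e)) (Num (w e))) es)"

text \<open>A finite set may be listed in an arbitrary order, without repetition.\<close>

definition enumerates :: "nat list \<Rightarrow> nat set \<Rightarrow> bool" where
  "enumerates xs A \<longleftrightarrow> distinct xs \<and> set xs = A"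

text \<open>
  A linear program over a product of sets \<^term>\<open>zero_on P S\<close> is the list of the objective vectors
  and the sets \<open>S\<close> of its factors.
\<close>

definition product_feasible ::
  "(nat \<Rightarrow> real) set \<Rightarrow> ((nat \<Rightarrow> real) \<times> nat list) list \<Rightarrow> (nat \<Rightarrow> real) list set" where
  "product_feasible P lp =
     {zs. length zs = length lp \<and> (\<forall>i<length lp. zs ! i \<in> zero_on P (set (snd (lp ! i))))}"

definition product_objective ::
  "nat set \<Rightarrow> ((nat \<Rightarrow> real) \<times> nat list) list \<Rightarrow> (nat \<Rightarrow> real) list \<Rightarrow> real" where
  "product_objective E lp zs = (\<Sum>i<length lp. dot E (fst (lp ! i)) (zs ! i))"

definition lp_code :: "nat list \<Rightarrow> ((nat \<Rightarrow> real) \<times> nat list) list \<Rightarrow> val" where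
  "lp_code es lp = list_code (map (\<lambda>(w, js). Pair (vec_code es w) (set_code js)) lp)"

text \<open>
  The oracle solving linear programs over products of at most \<open>m\<close> sets \<^term>\<open>zero_on P S\<close>; it
  returns the optimal value.
\<close>

definition lp_oracle :: "nat set \<Rightarrow> (nat \<Rightarrow> real) set \<Rightarrow> nat \<Rightarrow> val \<Rightarrow> val \<Rightarrow> bool" where
  "lp_oracle E P m x y \<longleftrightarrow>
     (\<exists>es lp v. enumerates es E \<and> length lp \<le> m \<and>
        (\<forall>(w, js)\<in>set lp. distinct js \<and> set js \<subseteq> E) \<and>
        is_max (product_feasible P lp) (product_objective E lp) v \<and>
        x = lp_code es lp \<and> y = Num v)"

text \<open>
  \<open>decides_with_lps p E K c b J m N\<close>: given only \<open>c\<close> and \<open>J\<close>, and with access to \<open>K\<close> solely through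
  linear programs over products of at most \<open>m\<close> sets, \<open>p\<close> answers \<open>b\<close> after solving at most \<open>N\<close> of
  them.
\<close>

definition decides_with_lps ::
  "prog \<Rightarrow> nat set \<Rightarrow> (nat \<Rightarrow> real) set \<Rightarrow> (nat \<Rightarrow> real) \<Rightarrow> nat set \<Rightarrow> bool \<Rightarrow> nat \<Rightarrow> nat \<Rightarrow> bool"
where
  "decides_with_lps p E K c J b m N \<longleftrightarrow>
     (\<forall>es js. enumerates es E \<longrightarrow> enumerates js J \<longrightarrow>
        (\<exists>t q. exec (lp_oracle E (truncation E K) m) p
                 (Pair (vec_code es c) (set_code js)) (bool_code b) t q \<and> q \<le> N))"

text \<open>
  A class of instances is a set \<open>R\<close> of triples \<open>(d, E, K)\<close>, where \<open>d\<close> is the description of the cone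
  \<open>K \<subseteq> \<real>\<^sup>E\<close> available to algorithms, for instance a list of linear inequalities or a
  combinatorial object from which \<open>K\<close> is constructed.
\<close>

definition instance_class :: "(val \<times> nat set \<times> (nat \<Rightarrow> real) set) set \<Rightarrow> bool" where
  "instance_class R \<longleftrightarrow> (\<forall>(d, E, K)\<in>R. rational_data d \<and> cone_instance E K)"

definition optimization_problem :: "(val \<times> nat set \<times> (nat \<Rightarrow> real) set) set \<Rightarrow> (val \<times> val) set" where
  "optimization_problem R =
     {(Pair d (Pair (vec_code es w) (set_code js)), Num v) | d E K es w js v.
        (d, E, K) \<in> R \<and> enumerates es E \<and> (\<forall>e\<in>E. w e \<in> \<rat>) \<and> distinct js \<and> set js \<subseteq> E \<and>
        is_max (zero_on (truncation E K) (set js)) (dot E w) v}"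

definition membership_problem ::
  "(val \<times> nat set \<times> (nat \<Rightarrow> real) set) set \<Rightarrow>
   (nat set \<Rightarrow> (nat \<Rightarrow> real) set \<Rightarrow> (nat \<Rightarrow> real) \<Rightarrow> real \<Rightarrow> nat set set) \<Rightarrow>
   (val \<times> nat \<times> bool) set" where
  "membership_problem R F =
     {(Pair d (Pair (vec_code es c) (set_code js)), card J, J \<in> F E (truncation E K) c \<alpha>)
        | d E K es c js J \<alpha>.
        (d, E, K) \<in> R \<and> enumerates es E \<and> (\<forall>e\<in>E. c e \<in> \<rat>) \<and> enumerates js J \<and> J \<subseteq> E \<and>
        is_max (truncation E K) (dot E c) \<alpha> \<and> \<alpha> > 0}"

end

theory Submission
  imports Defs "HOL-Library.Multiset"
begin

text \<open>
  Write \<open>v(S)\<close> for the maximum of \<open>c\<close> over the points of \<open>P\<close> that vanish on \<open>S\<close>, so that \<open>v({}) = \<alpha>\<close>.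
  Points \<open>z\<^sup>1, \<dots>, z\<^sup>l\<close> whose common support misses \<open>J\<close> assign to every \<open>e \<in> J\<close> an index \<open>i\<close> with
  \<open>z\<^sup>i(e) = 0\<close>; conversely, optimal points for the parts of a partition of \<open>J\<close> form such a tuple.
  Hence \<open>J\<close> lies in \<open>B\<^sub>l\<close> iff \<open>v(S\<^sub>1) + \<dots> + v(S\<^sub>l) \<le> (l - 1) \<alpha>\<close> for all ordered partitions of \<open>J\<close> into \<open>l\<close>
  possibly empty parts (\<open>B_fam_cover\<close>, \<open>B_famI\<close>).  In terms of the losses \<open>\<alpha> - v(S\<^sub>i)\<close> this says that
  they sum up to at least \<open>\<alpha>\<close>, and empty parts lose nothing.  So only the nonempty parts matter, there
  are at most \<open>|J|\<close> of them, and a nonempty \<open>J\<close> lies in \<open>B\<^sub>\<infinity>\<close> iff it lies in \<open>B\<^sub>l\<close> for \<open>l = |J|\<close>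
  (\<open>B_inf_iff_B_fam_card\<close>).  The empty set is in no family because \<open>\<alpha> > 0\<close>.

  The algorithm evaluates one product program per partition.  It is not told \<open>\<alpha>\<close>, and the bound of
  \<open>l\<^sup>k\<close> programs, \<open>k = |J| \<ge> 1\<close>, would be used up by the ordered partitions.  But the parts may be
  permuted: the first element of \<open>J\<close> is always put into the first part (\<open>B_fam_iff_completions\<close>), which leaves
  \<open>l\<^sup>k\<^sup>-\<^sup>1\<close> partitions.  The right-hand side \<open>(l - 1) \<alpha>\<close> is obtained as a sum of \<open>l - 1\<close> optimal values, and
  \<open>l\<^sup>k\<^sup>-\<^sup>1 + (l - 1) \<le> l\<^sup>k\<close>.  For \<open>l = 1\<close> no such value is needed, so that the bound is met with equality.

  The partitions are produced by a depth-first search with an explicit stack.  Both halves of the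
  claim use the same program \<open>search_prog\<close>; they differ in the subprogram that evaluates a product
  program.  For the query bound it is a query.  For tractability it adds up the values of the factors,
  each computed by the given polynomial-time solver.  Its running time is polynomial since the bit
  size of a sum of rationals is at most linear in the sum of the bit sizes (\<open>height_add\<close>).

  For the running time of the search it suffices that the number \<open>N\<close> of steps is bounded in terms of
  the parameter alone and that a step multiplies the size of the state by at most a constant: all
  states then have size at most \<open>a\<^sup>N n\<^sup>m\<close>, and polynomial-time steps take time \<open>b\<^sup>N n\<^sup>m\<^sup>'\<close> in total.
  As \<open>N\<close> is at most a constant to the power \<open>(\<kappa> + 1)\<^sup>2\<close>, this is a bound of the form \<open>f(\<kappa>) n\<^sup>m\<^sup>'\<close> for a
  double exponential \<open>f\<close>, which is computed by an explicit program (\<open>computable_double_power\<close>).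
\<close>

section \<open>Programs within time and query bounds\<close>

abbreviation sequence_prog :: "prog \<Rightarrow> prog \<Rightarrow> prog" (infixr ";;" 60) where
  "p ;; p' \<equiv> Then p p'"

primrec path :: "opr list \<Rightarrow> prog" where
  "path [] = Op Ident"
| "path (f # fs) = Op f ;; path fs"

primrec loop_free :: "prog \<Rightarrow> bool" where
  "loop_free (Op f) \<longleftrightarrow> True"
| "loop_free (Then p p') \<longleftrightarrow> loop_free p \<and> loop_free p'"
| "loop_free (Fork p p') \<longleftrightarrow> loop_free p \<and> loop_free p'"
| "loop_free (Cond b p p') \<longleftrightarrow> loop_free b \<and> loop_free p \<and> loop_free p'"
| "loop_free (While b p) \<longleftrightarrow> False"
| "loop_free Query \<longleftrightarrow> False"

text \<open>
  Arithmetic is excluded because a sum of irrational numbers, whose dummy size is 0, may be a rational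
  number of any size.  For the remaining operations the output is at most three times as long as the
  input.
\<close>

primrec arith_free :: "prog \<Rightarrow> bool" where
  "arith_free (Op f) \<longleftrightarrow> f \<notin> {Plus, Minus, Times, Divide}"
| "arith_free (Then p p') \<longleftrightarrow> arith_free p \<and> arith_free p'"
| "arith_free (Fork p p') \<longleftrightarrow> arith_free p \<and> arith_free p'"
| "arith_free (Cond b p p') \<longleftrightarrow> arith_free b \<and> arith_free p \<and> arith_free p'"
| "arith_free (While b p) \<longleftrightarrow> False"
| "arith_free Query \<longleftrightarrow> False"

primrec loop_free_value :: "prog \<Rightarrow> val \<Rightarrow> val" where
  "loop_free_value (Op f) x = apply_opr f x"
| "loop_free_value (Then p p') x = loop_free_value p' (loop_free_value p x)"
| "loop_free_value (Fork p p') x = Pair (loop_free_value p x) (loop_free_value p' x)"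
| "loop_free_value (Cond b p p') x = (if loop_free_value b x = Empty then loop_free_value p' x else loop_free_value p x)"
| "loop_free_value (While b p) x = Empty"
| "loop_free_value Query x = Empty"

text \<open>
  The time of a program without loops, queries and arithmetic is at most this factor times the size
  of its input.  An output is never longer than the time it took, whence the product for \<open>Then\<close>.
\<close>

primrec cost_factor :: "prog \<Rightarrow> nat" where
  "cost_factor (Op f) = 4"
| "cost_factor (Then p p') = cost_factor p + cost_factor p * cost_factor p'"
| "cost_factor (Fork p p') = 1 + cost_factor p + cost_factor p'"
| "cost_factor (Cond b p p') = 1 + cost_factor b + cost_factor p + cost_factor p'"
| "cost_factor (While b p) = 0"
| "cost_factor Query = 0"

lemma vsize_pos [simp]: "0 < vsize x" "Suc 0 \<le> vsize x"
  by (cases x; simp)+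

lemma rat_size_of_rat: "rat_size (of_rat q) =
    (case quotient_of q of (a, b) \<Rightarrow> floorlog 2 (nat \<bar>a\<bar>) + floorlog 2 (nat b))"
proof -
  have "(THE q'. of_rat q' = (of_rat q :: real)) = q" by (rule the_equality) auto
  then show ?thesis by (simp add: rat_size_def)
qed

lemma rat_size_0 [simp]: "rat_size 0 = 1"
  using rat_size_of_rat[of 0] by (simp add: floorlog_def)

lemma rat_size_1 [simp]: "rat_size 1 = 2"
  using rat_size_of_rat[of 1] by (simp add: floorlog_def)

lemma vsize_bool_code: "vsize (bool_code b) \<le> 3"
  by (simp add: bool_code_def)

lemma bool_code_eq [simp]: "bool_code b = Empty \<longleftrightarrow> \<not> b"  "bool_code True = Num 1"
  "bool_code False = Empty"
  by (simp_all add: bool_code_def)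

lemma binary_cases: "(\<exists>a b. x = Pair (Num a) (Num b) \<and> binary f x = f a b) \<or> binary f x = Empty"
  by (induction f x rule: binary.induct) auto

lemma vsize_apply_opr:
  assumes "f \<notin> {Plus, Minus, Times, Divide}"
  shows "vsize (apply_opr f x) \<le> 3 * vsize x"
proof -
  have *: "vsize (bool_code b) \<le> 3 * vsize x" for b
    using vsize_bool_code[of b] vsize_pos(2)[of x] by linarith
  show ?thesis
  proof (cases f)
    case Leq
    let ?g = "\<lambda>a b. bool_code (a \<le> b)"
    have "vsize (binary ?g x) \<le> 3"
      using binary_cases[of x ?g] by (auto simp: vsize_bool_code)
    then show ?thesis using Leq vsize_pos(1)[of x] by (simp only: apply_opr.simps)
  next
    case IsNum
    then show ?thesis using * by simp
  next
    case IsPair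
    then show ?thesis using * by simp
  next
    case MkOne
    then show ?thesis using vsize_pos(1)[of x]
      by (simp only: apply_opr.simps vsize.simps rat_size_1)
  qed (use assms vsize_pos(2)[of x] in \<open>auto split: val.split\<close>)
qed

text \<open>
  Every step is charged for its output, so a time bound is also a bound on the size of the output.
  This is how bounds on the sizes of numbers returned by a solver are obtained below.
\<close>

lemma exec_output_size: "exec orc p x y t q \<Longrightarrow> vsize y \<le> t"
proof (induction rule: exec.induct)
  case (Fork p x y t q p' y' t' q')
  then show ?case using vsize_pos(1)[of x] by (simp only: vsize.simps)
qed auto

lemma exec_rational:
  assumes "exec orc p x y t q" and "\<And>x y. orc x y \<Longrightarrow> rational_data y" and "rational_data x"
  shows "rational_data y"
proof -
  have op: "rational_data (apply_opr f x)" if "rational_data x" for f x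
  proof -
    have *: "rational_data (bool_code b)" for b by (simp add: bool_code_def)
    have **: "rational_data (binary g x)"
      if "\<And>a b. a \<in> \<rat> \<Longrightarrow> b \<in> \<rat> \<Longrightarrow> rational_data (g a b)" for g
      using binary_cases[of x g] that \<open>rational_data x\<close> by auto
    show ?thesis
      by (cases f) (use that * in \<open>auto intro!: ** split: val.split\<close>)
  qed
  show ?thesis
    using assms(1,3) by (induction rule: exec.induct) (auto intro: op assms(2))
qed

lemma exec_no_queries: "exec (\<lambda>_ _. False) p x y t q \<Longrightarrow> q = 0"
proof -
  have "exec orc p x y t q \<Longrightarrow> (\<And>x y. \<not> orc x y) \<Longrightarrow> q = 0" for orc
    by (induction rule: exec.induct) auto
  then show "exec (\<lambda>_ _. False) p x y t q \<Longrightarrow> q = 0" by blast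
qed

lemma exec_loop_free: "loop_free p \<Longrightarrow> \<exists>t. exec orc p x (loop_free_value p x) t 0"
proof (induction p arbitrary: x)
  case (Op f)
  then show ?case by (auto intro: exec.Op)
next
  case (Then p1 p2)
  then show ?case using exec.Then[where q=0 and q'=0] by simp metis
next
  case (Fork p1 p2)
  then show ?case using exec.Fork[where q=0 and q'=0] by simp metis
next
  case (Cond b p1 p2)
  then show ?case
    using exec.Cond_true[where r=0 and q=0] exec.Cond_false[where r=0 and q=0] by simp metis
qed auto

lemma arith_free_time:
  assumes "arith_free p" and "exec orc p x y t q"
  shows "t \<le> cost_factor p * vsize x"
  using assms
proof (induction p arbitrary: x y t q)
  case (Op f)
  from Op.prems(2) show ?case
  proof cases
    case Op
    then show ?thesis using vsize_apply_opr[of f x] \<open>arith_free (prog.Op f)\<close> by auto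
  qed
next
  case (Then p1 p2)
  from Then.prems(2) show ?case
  proof cases
    case (Then z t1 q1 t2 q2)
    have 1: "t1 \<le> cost_factor p1 * vsize x" using Then Then.IH Then.prems by auto
    have "t2 \<le> cost_factor p2 * vsize z" using Then Then.IH Then.prems by auto
    also have "\<dots> \<le> cost_factor p2 * (cost_factor p1 * vsize x)"
      using exec_output_size[OF Then(3)] 1 by (intro mult_left_mono) auto
    finally show ?thesis using 1 Then by (simp add: algebra_simps)
  qed
next
  case (Fork p1 p2)
  from Fork.prems(2) show ?case
    by cases (use Fork.IH Fork.prems in \<open>fastforce simp: algebra_simps\<close>)
next
  case (Cond b p1 p2)
  from Cond.prems(2) show ?case
  proof cases
    case (Cond_true u s r t1 q1)
    have "s \<le> cost_factor b * vsize x" "t1 \<le> cost_factor p1 * vsize x" using Cond_true Cond.IH Cond.prems by auto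
    then show ?thesis using Cond_true by (simp add: algebra_simps)
  next
    case (Cond_false s r t1 q1)
    have "s \<le> cost_factor b * vsize x" "t1 \<le> cost_factor p2 * vsize x" using Cond_false Cond.IH Cond.prems by auto
    then show ?thesis using Cond_false by (simp add: algebra_simps)
  qed
qed auto

text \<open>
  The flag \<open>timed\<close> allows the search to be verified once: with an oracle for linear programs only the
  queries are counted and the data may be irrational (\<open>timed = False\<close>), whereas with a
  polynomial-time solver the time matters (\<open>timed = True\<close>).
\<close>

definition runs_in :: "(val \<Rightarrow> val \<Rightarrow> bool) \<Rightarrow> bool \<Rightarrow> prog \<Rightarrow> val \<Rightarrow> val \<Rightarrow> nat \<Rightarrow> nat \<Rightarrow> bool"
  where "runs_in orc timed p x y T Q \<longleftrightarrow>
    (\<exists>t q. exec orc p x y t q \<and> (timed \<longrightarrow> t \<le> T) \<and> q \<le> Q)"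

lemma runs_in_mono:
  assumes "runs_in orc timed p x y T Q" and "timed \<Longrightarrow> T \<le> T'" and "Q \<le> Q'"
  shows "runs_in orc timed p x y T' Q'"
  using assms unfolding runs_in_def by (meson le_trans)

lemma runs_in_output_size: "runs_in orc True p x y T Q \<Longrightarrow> vsize y \<le> T"
  unfolding runs_in_def using exec_output_size le_trans by blast

lemma runs_in_rational:
  assumes "runs_in orc timed p x y T Q" and "\<And>x y. orc x y \<Longrightarrow> rational_data y"
    and "rational_data x"
  shows "rational_data y"
  using assms exec_rational unfolding runs_in_def by blast

lemma runs_in_arith_free:
  assumes "loop_free p" and "arith_free p" and "loop_free_value p x = y" and "cost_factor p = c"
  shows "runs_in orc timed p x y (c * vsize x) 0"
  using exec_loop_free[OF assms(1)] arith_free_time[OF assms(2)] assms(3,4)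
  unfolding runs_in_def by blast

lemma runs_in_Op: "y = apply_opr f x \<Longrightarrow> runs_in orc timed (Op f) x y (vsize x + vsize y) 0"
  unfolding runs_in_def by (auto intro!: exec.Op)

lemma runs_in_Then:
  assumes "runs_in orc timed p x y T Q" and "runs_in orc timed p' y z T' Q'"
  shows "runs_in orc timed (p ;; p') x z (T + T') (Q + Q')"
  using assms unfolding runs_in_def by (meson add_mono exec.Then)

lemma runs_in_Fork:
  assumes "runs_in orc timed p x y T Q" and "runs_in orc timed p' x y' T' Q'"
  shows "runs_in orc timed (Fork p p') x (Pair y y') (vsize x + T + T') (Q + Q')"
  using assms unfolding runs_in_def by (meson add_mono exec.Fork order_refl)

lemma runs_in_Cond_true:
  assumes "runs_in orc timed b x u S Q'" and "u \<noteq> Empty" and "runs_in orc timed p x y T Q"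
  shows "runs_in orc timed (Cond b p p') x y (vsize x + S + T) (Q' + Q)"
  using assms unfolding runs_in_def by (meson add_mono exec.Cond_true order_refl)

lemma runs_in_Cond_false:
  assumes "runs_in orc timed b x Empty S Q'" and "runs_in orc timed p' x y T Q"
  shows "runs_in orc timed (Cond b p p') x y (vsize x + S + T) (Q' + Q)"
  using assms unfolding runs_in_def by (meson add_mono exec.Cond_false order_refl)

text \<open>
  The loop acts on abstract states, represented by \<open>code\<close>.  The measure \<open>m\<close> bounds the number of
  iterations, and \<open>Q\<close> is a potential from which each iteration pays for its queries.  A uniform bound
  \<open>T\<close> on the time of an iteration is enough since the invariant \<open>I\<close> can limit the size of the state.
\<close>

lemma runs_in_While:
  fixes code :: "'s \<Rightarrow> val" and m Q :: "'s \<Rightarrow> nat"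
  assumes test: "\<And>s. I s \<Longrightarrow> runs_in orc timed b (code s) (bool_code (G s)) (U s) 0"
    and step: "\<And>s. I s \<Longrightarrow> G s \<Longrightarrow> \<exists>s' q. runs_in orc timed p (code s) (code s') (V s) q \<and>
      I s' \<and> m s' < m s \<and> q + Q s' \<le> Q s"
    and bound: "\<And>s. I s \<Longrightarrow> timed \<Longrightarrow> vsize (code s) + U s + V s \<le> T"
    and "I s"
  shows "\<exists>s'. I s' \<and> \<not> G s' \<and>
    runs_in orc timed (While b p) (code s) (code s') ((m s + 1) * T) (Q s)"
  using \<open>I s\<close>
proof (induction "m s" arbitrary: s rule: less_induct)
  case less
  obtain u r where b: "exec orc b (code s) (bool_code (G s)) u r" "timed \<longrightarrow> u \<le> U s" "r = 0"
    using test[OF less.prems] unfolding runs_in_def by auto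
  show ?case
  proof (cases "G s")
    case False
    then have "exec orc (While b p) (code s) (code s) (vsize (code s) + u) r"
      using b by (auto intro: exec.While_stop)
    moreover have "vsize (code s) + u \<le> (m s + 1) * T" if timed
    proof -
      have "vsize (code s) + u \<le> T" using bound[OF less.prems that] b that by auto
      then show ?thesis by (simp add: trans_le_add1)
    qed
    ultimately show ?thesis using False less.prems b unfolding runs_in_def by auto
  next
    case True
    obtain s' q0 where s': "runs_in orc timed p (code s) (code s') (V s) q0" "I s'" "m s' < m s"
        "q0 + Q s' \<le> Q s"
      using step[OF less.prems True] by blast
    obtain t q where tq: "exec orc p (code s) (code s') t q" "timed \<longrightarrow> t \<le> V s" "q \<le> q0"
      using s'(1) unfolding runs_in_def by auto
    obtain s'' t2 q2 where s'': "I s''" "\<not> G s''" "exec orc (While b p) (code s') (code s'') t2 q2"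
        "timed \<longrightarrow> t2 \<le> (m s' + 1) * T" "q2 \<le> Q s'"
      using less.hyps[OF s'(3,2)] unfolding runs_in_def by auto
    have "exec orc (While b p) (code s) (code s'') (vsize (code s) + u + t + t2) (r + q + q2)"
      using exec.While_step[OF b(1) _ tq(1) s''(3)] True by simp
    moreover have "vsize (code s) + u + t + t2 \<le> (m s + 1) * T" if timed
    proof -
      have "vsize (code s) + u + t + t2 \<le> T + (m s' + 1) * T"
        using bound[OF less.prems that] b tq s'' that by auto
      also have "\<dots> = (m s' + 2) * T" by simp
      also have "\<dots> \<le> (m s + 1) * T" using s'(3) by (intro mult_right_mono) auto
      finally show ?thesis .
    qed
    moreover have "r + q + q2 \<le> Q s" using b tq s'' s' by auto
    ultimately show ?thesis using s'' unfolding runs_in_def by blast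
  qed
qed

section \<open>Bit sizes of sums\<close>

text \<open>
  Numerator plus denominator of a reduced fraction.  Its logarithm is the bit size up to constants,
  and unlike the bit size it is submultiplicative under addition, so that adding up many numbers does
  not multiply the constants.
\<close>

definition height :: "real \<Rightarrow> nat" where
  "height r = (case quotient_of (THE q. of_rat q = r) of (a, b) \<Rightarrow> nat \<bar>a\<bar> + nat b)"

lemma height_of_rat: "height (of_rat q) = (case quotient_of q of (a, b) \<Rightarrow> nat \<bar>a\<bar> + nat b)"
proof -
  have "(THE q'. of_rat q' = (of_rat q :: real)) = q" by (rule the_equality) auto
  then show ?thesis by (simp add: height_def)
qed

lemma height_fraction_le:
  assumes "of_rat q = real_of_int x / real_of_int y" and "y > 0"
  shows "height (of_rat q) \<le> nat \<bar>x\<bar> + nat y"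
proof -
  obtain a b where ab: "quotient_of q = (a, b)" by fastforce
  have b: "b > 0" and cop: "coprime a b"
    using quotient_of_denom_pos[OF ab] quotient_of_coprime[OF ab] .
  have "real_of_int a / real_of_int b = real_of_int x / real_of_int y"
    using assms(1) quotient_of_div[OF ab] by (simp add: of_rat_divide)
  then have "real_of_int (a * y) = real_of_int (x * b)" using b assms(2) by (simp add: field_simps)
  then have eq: "a * y = x * b" by linarith
  then have "b dvd y" using cop by (metis coprime_commute coprime_dvd_mult_right_iff dvd_triv_right)
  then obtain k where k: "y = b * k" by auto
  have "k > 0" using k b assms(2) by (simp add: zero_less_mult_iff)
  have "x = a * k" using eq k b by (simp add: algebra_simps)
  then have "\<bar>a\<bar> \<le> \<bar>x\<bar>" using \<open>k > 0\<close> by (simp add: abs_mult mult_le_cancel_left1)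
  moreover have "b \<le> y" using k \<open>k > 0\<close> b by (simp add: mult_le_cancel_left1)
  ultimately show ?thesis using ab by (simp add: height_of_rat)
qed

text \<open>
  Since \<open>a/b + c/d = (a d + c b)/(b d)\<close>, and reducing a fraction does not increase its height, this
  follows from \<open>|a d + c b| + b d \<le> (|a| + b) (|c| + d)\<close>.
\<close>

lemma height_add:
  assumes "r \<in> \<rat>" and "s \<in> \<rat>"
  shows "height (r + s) \<le> height r * height s"
proof -
  obtain p q where pq: "r = of_rat p" "s = of_rat q" using assms by (auto elim!: Rats_cases)
  obtain a b where ab: "quotient_of p = (a, b)" by fastforce
  obtain c d where cd: "quotient_of q = (c, d)" by fastforce
  have pos: "b > 0" "d > 0" using quotient_of_denom_pos ab cd by blast+
  have "of_rat (p + q) = real_of_int (a * d + c * b) / real_of_int (b * d)"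
    using quotient_of_div[OF ab] quotient_of_div[OF cd] pos
    by (simp add: of_rat_add of_rat_divide of_rat_mult add_frac_eq)
  then have "height (of_rat (p + q)) \<le> nat \<bar>a * d + c * b\<bar> + nat (b * d)"
    using pos by (intro height_fraction_le) auto
  also have "\<dots> \<le> (nat \<bar>a\<bar> + nat b) * (nat \<bar>c\<bar> + nat d)"
  proof -
    have "\<bar>a * d + c * b\<bar> \<le> \<bar>a\<bar> * d + \<bar>c\<bar> * b"
      using abs_triangle_ineq[of "a * d" "c * b"] pos by (simp add: abs_mult)
    moreover have "0 \<le> \<bar>a\<bar> * \<bar>c\<bar>" by simp
    ultimately have "\<bar>a * d + c * b\<bar> + b * d \<le> \<bar>a\<bar> * d + \<bar>c\<bar> * b + b * d + \<bar>a\<bar> * \<bar>c\<bar>"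
      by linarith
    also have "\<dots> = (\<bar>a\<bar> + b) * (\<bar>c\<bar> + d)" by (simp add: algebra_simps)
    finally have "\<bar>a * d + c * b\<bar> + b * d \<le> (\<bar>a\<bar> + b) * (\<bar>c\<bar> + d)" .
    then have "int (nat \<bar>a * d + c * b\<bar> + nat (b * d)) \<le> int ((nat \<bar>a\<bar> + nat b) * (nat \<bar>c\<bar> + nat d))"
      using pos by (simp only: of_nat_add of_nat_mult) simp
    then show ?thesis by linarith
  qed
  finally show ?thesis using pq ab cd by (simp add: height_of_rat of_rat_add)
qed

lemma height_0 [simp]: "height 0 = 1"
  using height_of_rat[of 0] by simp

lemma le_2_pow_floorlog: "n \<le> 2 ^ floorlog 2 n"
  using floorlog_bounds[of n 2] by (cases "n = 0") auto

lemma floorlog_le: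
  assumes "n \<le> 2 ^ k" shows "floorlog 2 n \<le> k + 1"
proof -
  have "0 < (2::nat) ^ k" by simp
  then have "n < 2 * 2 ^ k" using assms by linarith
  then have "n < 2 ^ (k + 1)" by simp
  then show ?thesis by (intro floorlog_leI) auto
qed

text \<open>
  For a nonzero number, \<open>2\<^sup>x + 2\<^sup>y \<le> 2\<^sup>x\<^sup>+\<^sup>y\<close> for the lengths \<open>x, y \<ge> 1\<close> of numerator and denominator.  The
  numerator 0 has length 0, but then the denominator is 1.
\<close>

lemma height_le_rat_size:
  assumes "r \<in> \<rat>" shows "height r \<le> 2 ^ rat_size r"
proof -
  obtain q where q: "r = of_rat q" using assms by (auto elim!: Rats_cases)
  obtain a b where ab: "quotient_of q = (a, b)" by fastforce
  have b: "b > 0" using quotient_of_denom_pos[OF ab] .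
  define x y where "x = floorlog 2 (nat \<bar>a\<bar>)" and "y = floorlog 2 (nat b)"
  have y1: "1 \<le> y" using b unfolding y_def by (simp add: floorlog_def)
  have h: "height r = nat \<bar>a\<bar> + nat b" and s: "rat_size r = x + y"
    using q ab by (auto simp: height_of_rat rat_size_of_rat x_def y_def)
  show ?thesis
  proof (cases "a = 0")
    case True
    then have "b = 1" using quotient_of_coprime[OF ab] b by simp
    then show ?thesis using True h by simp
  next
    case False
    then have x1: "1 \<le> x" unfolding x_def by (simp add: floorlog_def)
    have "nat \<bar>a\<bar> + nat b \<le> 2 ^ x + 2 ^ y"
      unfolding x_def y_def by (intro add_mono le_2_pow_floorlog)
    also have "\<dots> \<le> 2 ^ x * 2 ^ y"
    proof -
      have "(2::nat) \<le> 2 ^ x" "(2::nat) \<le> 2 ^ y"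
        using power_increasing[of 1 x "2::nat"] power_increasing[of 1 y "2::nat"] x1 y1 by auto
      then obtain i j where "(2::nat) ^ x = 2 + i" "(2::nat) ^ y = 2 + j" using le_Suc_ex by metis
      then show ?thesis by (simp add: algebra_simps)
    qed
    finally show ?thesis using h s by (simp add: power_add)
  qed
qed

lemma rat_size_le_height:
  assumes "r \<in> \<rat>" and "height r \<le> 2 ^ k"
  shows "rat_size r \<le> 2 * (k + 1)"
proof -
  obtain q where q: "r = of_rat q" using assms by (auto elim!: Rats_cases)
  obtain a b where ab: "quotient_of q = (a, b)" by fastforce
  have "nat \<bar>a\<bar> + nat b \<le> 2 ^ k" using assms(2) q ab by (simp add: height_of_rat)
  then have "nat \<bar>a\<bar> \<le> 2 ^ k" "nat b \<le> 2 ^ k" by linarith+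
  then have "floorlog 2 (nat \<bar>a\<bar>) \<le> k + 1" "floorlog 2 (nat b) \<le> k + 1"
    using floorlog_le by blast+
  then show ?thesis using q ab by (simp add: rat_size_of_rat)
qed

section \<open>Summation over a list\<close>

text \<open>
  The only number built into programs is 1.
\<close>

definition zero_prog :: prog where
  "zero_prog = Fork (Op MkOne) (Op MkOne) ;; Op Minus"

definition sum_body :: "prog \<Rightarrow> prog" where
  "sum_body B = Fork (path [Left, Right]) (Fork (path [Right, Left])
     (Fork (path [Right, Right]) (Fork (path [Left, Left]) (path [Right, Left]) ;; B) ;; Op Plus))"

text \<open>
  The input is a pair of a list and a context; \<open>B\<close> receives an entry together with the context and
  returns a number.  The state of the loop is \<open>(remaining list, (context, partial sum))\<close>.
\<close>

definition sum_prog :: "prog \<Rightarrow> prog" where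
  "sum_prog B = Fork (Op Left) (Fork (Op Right) zero_prog) ;;
     While (path [Left, IsPair]) (sum_body B) ;; path [Right, Right]"

lemma vsize_list_code_append:
  "vsize (list_code ys) \<le> vsize (list_code (xs @ ys))"
  by (induction xs) auto

lemma rational_list_code: "rational_data (list_code xs) \<longleftrightarrow> (\<forall>x\<in>set xs. rational_data x)"
  by (induction xs) auto

lemma length_less_vsize_list_code: "length xs < vsize (list_code xs)"
proof (induction xs)
  case (Cons x xs)
  then show ?case by simp
qed simp

lemma runs_in_zero_prog: "runs_in orc timed zero_prog x (Num 0) (4 * vsize x + 20) 0"
proof -
  have one: "runs_in orc timed (Op MkOne) x (Num 1) (vsize x + 3) 0"
    by (rule runs_in_mono[OF runs_in_Op]) simp_all
  have "runs_in orc timed zero_prog x (Num 0)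
      ((vsize x + (vsize x + 3) + (vsize x + 3)) + (vsize (Pair (Num 1) (Num 1)) + vsize (Num 0)))
      (0 + 0 + 0)"
    unfolding zero_prog_def
    by (intro runs_in_Then[OF runs_in_Fork[OF one one]] runs_in_Op) simp
  then show ?thesis by (rule runs_in_mono) auto
qed

lemma height_sum_le:
  assumes "\<And>z. z \<in> set zs \<Longrightarrow> r z \<in> \<rat> \<and> rat_size (r z) \<le> T"
  shows "(\<Sum>z\<leftarrow>zs. r z) \<in> \<rat> \<and> height (\<Sum>z\<leftarrow>zs. r z) \<le> 2 ^ (length zs * T)"
  using assms
proof (induction zs)
  case (Cons z zs)
  have "height (r z) \<le> 2 ^ T"
    using height_le_rat_size[of "r z"] power_increasing[of "rat_size (r z)" T "2::nat"] Cons.prems[of z]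
    by (auto intro: le_trans)
  moreover have IH: "(\<Sum>z\<leftarrow>zs. r z) \<in> \<rat>" "height (\<Sum>z\<leftarrow>zs. r z) \<le> 2 ^ (length zs * T)"
    using Cons by auto
  ultimately have "height (r z) * height (\<Sum>z\<leftarrow>zs. r z) \<le> 2 ^ T * 2 ^ (length zs * T)"
    by (intro mult_le_mono)
  then have "height (r z + (\<Sum>z\<leftarrow>zs. r z)) \<le> 2 ^ T * 2 ^ (length zs * T)"
    using height_add[of "r z" "\<Sum>z\<leftarrow>zs. r z"] Cons.prems[of z] IH by (auto intro: le_trans)
  then show ?case using Cons.prems[of z] IH by (simp add: power_add)
qed simp

text \<open>
  If the values take time \<open>T\<close>, they have bit size at most \<open>T\<close>, and the partial sums therefore have
  heights at most \<open>2\<close> to the power \<open>n T\<close>.  So every state, and every iteration, stays within a multiple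
  of \<open>n (T + 1)\<close>, and there are at most \<open>n\<close> iterations.  The numerical constants are not optimized.
\<close>

lemma runs_in_sum_prog:
  fixes f :: "'z \<Rightarrow> val" and r :: "'z \<Rightarrow> real" and zs :: "'z list"
  assumes B: "\<And>z. z \<in> set zs \<Longrightarrow> runs_in orc timed B (Pair (f z) ctx) (Num (r z)) T Q"
    and rational: "timed \<Longrightarrow> rational_data (Pair (list_code (map f zs)) ctx)"
    and orc: "\<And>x y. timed \<Longrightarrow> orc x y \<Longrightarrow> rational_data y"
  shows "runs_in orc timed (sum_prog B) (Pair (list_code (map f zs)) ctx) (Num (\<Sum>z\<leftarrow>zs. r z))
    (20000 * vsize (Pair (list_code (map f zs)) ctx) ^ 2 * (T + 1)) (length zs * Q)"
proof -
  define n where "n = vsize (Pair (list_code (map f zs)) ctx)"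
  define S where "S = 5 * (n * (T + 1))"
  define code where "code = (\<lambda>(ys, acc). Pair (list_code (map f ys)) (Pair ctx (Num acc)))"
  define I where "I = (\<lambda>(ys, acc). \<exists>xs. zs = xs @ ys \<and> acc = (\<Sum>z\<leftarrow>xs. r z))"
  have len: "length zs + 3 \<le> n"
    using length_less_vsize_list_code[of "map f zs"] vsize_pos(1)[of ctx]
    unfolding n_def vsize.simps length_map by linarith
  have rz: "r z \<in> \<rat> \<and> rat_size (r z) \<le> T" if "z \<in> set zs" timed for z
  proof -
    have "rational_data (Pair (f z) ctx)"
      using rational[OF that(2)] that(1) by (simp add: rational_list_code)
    then have "rational_data (Num (r z))"
      by (intro runs_in_rational[OF B[OF that(1)]]) (use orc[OF that(2)] in blast)+
    moreover have "vsize (Num (r z)) \<le> T"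
      by (rule runs_in_output_size) (use B[OF that(1)] that(2) in simp)
    ultimately show ?thesis by simp
  qed
  have size: "vsize (code s) \<le> S" if s: "I s" and timed for s
  proof -
    obtain ys acc xs where s': "s = (ys, acc)" "zs = xs @ ys" "acc = (\<Sum>z\<leftarrow>xs. r z)"
      using s unfolding I_def by (cases s) auto
    have "acc \<in> \<rat> \<and> height acc \<le> 2 ^ (length xs * T)"
      unfolding s'(3) by (rule height_sum_le) (use rz s' \<open>timed\<close> in auto)
    then have "rat_size acc \<le> 2 * (length xs * T + 1)" using rat_size_le_height by blast
    also have "\<dots> \<le> 2 * (n * T + 1)" using len s'(2) by (intro mult_left_mono add_right_mono mult_right_mono) auto
    finally have acc: "rat_size acc \<le> 2 * (n * T) + 2" by simp
    have ls: "vsize (list_code (map f ys)) + vsize ctx + 1 \<le> n"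
      using vsize_list_code_append[of "map f ys" "map f xs"] s'(2) by (simp add: n_def)
    have "vsize (code s) = vsize (list_code (map f ys)) + vsize ctx + rat_size acc + 3"
      by (simp add: code_def s')
    then show ?thesis using acc ls len unfolding S_def by (simp add: algebra_simps)
  qed
  have "1 * (T + 1) \<le> n * (T + 1)" using len by (intro mult_right_mono) auto
  also have "\<dots> \<le> 5 * (n * (T + 1))" by simp
  finally have TS: "T + 1 \<le> S" unfolding S_def by simp
  have body: "runs_in orc timed (sum_body B) (code (z # ys, acc)) (code (ys, acc + r z)) (600 * S) Q"
    if I: "I (z # ys, acc)" for z ys acc
  proof -
    let ?s = "code (z # ys, acc)"
    have z: "z \<in> set zs" using I unfolding I_def by auto
    have I': "I (ys, acc + r z)"
    proof -
      obtain xs where "zs = xs @ z # ys" "acc = (\<Sum>z\<leftarrow>xs. r z)" using I unfolding I_def by auto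
      then show ?thesis unfolding I_def by (auto intro!: exI[of _ "xs @ [z]"])
    qed
    have p: "runs_in orc timed (path [Left, Left]) ?s (f z) (84 * vsize ?s) 0"
        "runs_in orc timed (path [Left, Right]) ?s (list_code (map f ys)) (84 * vsize ?s) 0"
        "runs_in orc timed (path [Right, Left]) ?s ctx (84 * vsize ?s) 0"
        "runs_in orc timed (path [Right, Right]) ?s (Num acc) (84 * vsize ?s) 0"
      by (rule runs_in_arith_free; simp add: code_def)+
    have plus: "runs_in orc timed (Op Plus) (Pair (Num acc) (Num (r z))) (Num (acc + r z))
        (vsize (Pair (Num acc) (Num (r z))) + vsize (Num (acc + r z))) 0"
      by (rule runs_in_Op) simp
    note b = runs_in_Then[OF runs_in_Fork[OF p(1,3)] B[OF z]]
    note b' = runs_in_Then[OF runs_in_Fork[OF p(4) b] plus]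
    have "runs_in orc timed (sum_body B) ?s (code (ys, acc + r z))
       (vsize ?s + 84 * vsize ?s + (vsize ?s + 84 * vsize ?s + (vsize ?s + 84 * vsize ?s + (vsize ?s + 84 * vsize ?s + 84 * vsize ?s + T) +
          (vsize (Pair (Num acc) (Num (r z))) + vsize (Num (acc + r z)))))) (0 + (0 + (0 + (0 + 0 + Q) + 0)))"
      using runs_in_Fork[OF p(2) runs_in_Fork[OF p(3) b']]
      unfolding sum_body_def by (simp only: code_def prod.case)
    then show ?thesis
    proof (rule runs_in_mono)
      assume timed
      have "vsize ?s \<le> S" "vsize (code (ys, acc + r z)) \<le> S" using size I I' \<open>timed\<close> by blast+
      moreover have "vsize (Num acc) \<le> vsize ?s" "vsize (Num (acc + r z)) \<le> vsize (code (ys, acc + r z))"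
        by (simp_all add: code_def)
      moreover have "rat_size (r z) \<le> T" using rz[OF z \<open>timed\<close>] by simp
      ultimately show "vsize ?s + 84 * vsize ?s + (vsize ?s + 84 * vsize ?s + (vsize ?s + 84 * vsize ?s + (vsize ?s + 84 * vsize ?s + 84 * vsize ?s + T) +
          (vsize (Pair (Num acc) (Num (r z))) + vsize (Num (acc + r z))))) \<le> 600 * S"
        using TS by simp
    qed simp
  qed
  have start: "I (zs, 0)" by (simp add: I_def)
  have "\<exists>s'. I s' \<and> \<not> fst s' \<noteq> [] \<and>
      runs_in orc timed (While (path [Left, IsPair]) (sum_body B)) (code (zs, 0)) (code s')
        ((length (fst (zs, 0::real)) + 1) * (685 * S)) (length (fst (zs, 0::real)) * Q)"
  proof (rule runs_in_While[where I=I and code=code and s="(zs, 0)" and T="685 * S" and G="\<lambda>s. fst s \<noteq> []" and U="\<lambda>s. 84 * vsize (code s)" and V="\<lambda>_. 600 * S"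
        and m="\<lambda>s. length (fst s)" and Q="\<lambda>s. length (fst s) * Q"])
    fix s assume "I s"
    show "runs_in orc timed (path [Left, IsPair]) (code s) (bool_code (fst s \<noteq> [])) (84 * vsize (code s)) 0"
      by (rule runs_in_arith_free; cases s; cases "fst s") (simp_all add: code_def)
    show "\<exists>s' q. runs_in orc timed (sum_body B) (code s) (code s') (600 * S) q \<and> I s' \<and>
      length (fst s') < length (fst s) \<and> q + length (fst s') * Q \<le> length (fst s) * Q"
      if ne: "fst s \<noteq> []"
    proof -
      obtain z ys acc where s: "s = (z # ys, acc)" using ne by (cases s; cases "fst s") auto
      obtain xs where "zs = xs @ z # ys" "acc = (\<Sum>z\<leftarrow>xs. r z)" using \<open>I s\<close> s unfolding I_def by auto
      then have "I (ys, acc + r z)" unfolding I_def by (auto intro!: exI[of _ "xs @ [z]"])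
      then show ?thesis using body[of z ys acc] \<open>I s\<close> s
        by (intro exI[of _ "(ys, acc + r z)"] exI[of _ Q]) auto
    qed
    show "vsize (code s) + 84 * vsize (code s) + 600 * S \<le> 685 * S" if timed
      using size[OF \<open>I s\<close> that] by linarith
  qed (rule start)
  then obtain acc where loop: "I ([], acc)"
      "runs_in orc timed (While (path [Left, IsPair]) (sum_body B)) (code (zs, 0)) (code ([], acc))
        ((length zs + 1) * (685 * S)) (length zs * Q)"
    by auto
  have acc: "acc = (\<Sum>z\<leftarrow>zs. r z)" using loop(1) unfolding I_def by auto
  let ?x = "Pair (list_code (map f zs)) ctx"
  have op: "runs_in orc timed (Op Left) ?x (list_code (map f zs)) (4 * vsize ?x) 0"
    "runs_in orc timed (Op Right) ?x ctx (4 * vsize ?x) 0"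
    by (rule runs_in_arith_free; simp)+
  have init: "runs_in orc timed (Fork (Op Left) (Fork (Op Right) zero_prog)) ?x (code (zs, 0))
      (n + 4 * n + (n + 4 * n + (4 * n + 20))) (0 + (0 + 0))"
    using runs_in_Fork[OF op(1) runs_in_Fork[OF op(2) runs_in_zero_prog]]
    by (simp only: n_def code_def prod.case)
  have final: "runs_in orc timed (path [Right, Right]) (code ([], acc)) (Num acc) (84 * vsize (code ([], acc))) 0"
    by (rule runs_in_arith_free) (simp_all add: code_def)
  have "runs_in orc timed (sum_prog B) ?x (Num acc)
      ((n + 4 * n + (n + 4 * n + (4 * n + 20))) + ((length zs + 1) * (685 * S) + 84 * vsize (code ([], acc))))
      ((0 + (0 + 0)) + (length zs * Q + 0))"
    unfolding sum_prog_def by (rule runs_in_Then[OF init runs_in_Then[OF loop(2) final]])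
  then show ?thesis unfolding acc
  proof (rule runs_in_mono)
    assume timed
    have "vsize (code ([], \<Sum>z\<leftarrow>zs. r z)) \<le> S" using size[OF loop(1) \<open>timed\<close>] acc by simp
    moreover have "(length zs + 1) * (685 * S) \<le> n * (685 * S)" using len by (intro mult_right_mono) auto
    moreover have "S \<le> n * S" "n \<le> n * S" "20 \<le> 20 * (n * S)" using len TS by (auto simp: Suc_le_eq)
    ultimately have "n + 4 * n + (n + 4 * n + (4 * n + 20)) + ((length zs + 1) * (685 * S) + 84 * vsize (code ([], \<Sum>z\<leftarrow>zs. r z)))
      \<le> 1000 * (n * S)" by linarith
    also have "\<dots> \<le> 20000 * n ^ 2 * (T + 1)" unfolding S_def by (simp add: power2_eq_square algebra_simps)
    finally show "n + 4 * n + (n + 4 * n + (4 * n + 20)) + ((length zs + 1) * (685 * S) + 84 * vsize (code ([], \<Sum>z\<leftarrow>zs. r z)))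
      \<le> 20000 * vsize ?x ^ 2 * (T + 1)" unfolding n_def .
  qed simp
qed

section \<open>Optimal values and the partition criterion\<close>

lemma is_max_unique: "is_max X f v \<Longrightarrow> is_max X f v' \<Longrightarrow> v = v'"
  unfolding is_max_def by (metis order.antisym)

text \<open>
  An extensional function is a point of a product over the whole index type whose
  factors outside \<open>E\<close> are singletons, so Tychonoff's theorem applies.
\<close>

lemma compact_unit_box: "compact (E \<rightarrow>\<^sub>E {0..1::real})"
proof -
  have "compactin (product_topology (\<lambda>_::'a. euclidean) UNIV)
      (PiE UNIV (\<lambda>e. if e \<in> E then {0..1::real} else {undefined}))"
    unfolding compactin_PiE by auto
  moreover have "PiE UNIV (\<lambda>e. if e \<in> E then {0..1::real} else {undefined}) = E \<rightarrow>\<^sub>E {0..1}"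
    by (auto simp: PiE_def Pi_def extensional_def split: if_splits)
  ultimately show ?thesis by (simp add: euclidean_product_topology)
qed

lemma continuous_on_dot: "continuous_on X (dot E a)"
  unfolding dot_def
  by (intro continuous_intros continuous_on_subset[OF continuous_on_product_coordinates]) auto

lemma is_max_zero_on_exists:
  assumes "cone_instance E K" and "S \<subseteq> E"
  shows "\<exists>v. is_max (zero_on (truncation E K) S) (dot E c) v"
proof -
  let ?X = "zero_on (truncation E K) S"
  obtain A where K: "K = {y \<in> E \<rightarrow>\<^sub>E UNIV. \<forall>a\<in>A. dot E a y \<le> 0}"
    using assms(1) unfolding cone_instance_def rational_polyhedral_cone_def by auto
  have "?X = (E \<rightarrow>\<^sub>E {0..1}) \<inter> ((\<Inter>a\<in>A. {y. dot E a y \<le> 0}) \<inter> (\<Inter>e\<in>S. {y. y e = 0}))"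
    unfolding K zero_on_def truncation_def by (auto simp: PiE_def)
  moreover have "closed ((\<Inter>a\<in>A. {y. dot E a y \<le> 0}) \<inter> (\<Inter>e\<in>S. {y :: nat \<Rightarrow> real. y e = 0}))"
    by (intro closed_Int closed_INT ballI closed_Collect_le closed_Collect_eq continuous_on_dot
        continuous_on_const continuous_on_product_coordinates)
  ultimately have "compact ?X" using compact_Int_closed[OF compact_unit_box] by metis
  moreover have "(\<lambda>e\<in>E. 0) \<in> ?X"
    using assms(2) unfolding K zero_on_def truncation_def by (auto simp: dot_def)
  ultimately obtain z where "z \<in> ?X" "\<forall>y\<in>?X. dot E c y \<le> dot E c z"
    using continuous_attains_sup[OF _ _ continuous_on_dot] by blast
  then show ?thesis unfolding is_max_def by blast
qed

definition opt_value :: "nat set \<Rightarrow> (nat \<Rightarrow> real) set \<Rightarrow> (nat \<Rightarrow> real) \<Rightarrow> nat set \<Rightarrow> real" where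
  "opt_value E K c S = (THE v. is_max (zero_on (truncation E K) S) (dot E c) v)"

lemma is_max_opt_value:
  assumes "cone_instance E K" and "S \<subseteq> E"
  shows "is_max (zero_on (truncation E K) S) (dot E c) (opt_value E K c S)"
  unfolding opt_value_def using is_max_zero_on_exists[OF assms] is_max_unique by (metis theI_unique)

lemma opt_value_empty:
  assumes "is_max (truncation E K) (dot E c) \<alpha>"
  shows "opt_value E K c {} = \<alpha>"
  unfolding opt_value_def by (rule the_equality) (use assms is_max_unique in \<open>auto simp: zero_on_def\<close>)

text \<open>
  Optimal points for the sets \<open>S i\<close> have no common support in \<open>J\<close>, as every element of \<open>J\<close> is a
  prescribed zero of one of them.
\<close>

lemma B_fam_cover:
  assumes cone: "cone_instance E K" and J: "J \<in> B_fam l E (truncation E K) c \<alpha>"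
    and cover: "J \<subseteq> (\<Union>i\<in>{1..l}. S i)" and sub: "\<And>i. i \<in> {1..l} \<Longrightarrow> S i \<subseteq> E"
  shows "(\<Sum>i\<in>{1..l}. opt_value E K c (S i)) \<le> \<alpha> * (real l - 1)"
proof -
  have "\<forall>i\<in>{1..l}. \<exists>z. z \<in> zero_on (truncation E K) (S i) \<and> dot E c z = opt_value E K c (S i)"
    using is_max_opt_value[OF cone sub] unfolding is_max_def by blast
  then obtain z where z: "\<And>i. i \<in> {1..l} \<Longrightarrow> z i \<in> zero_on (truncation E K) (S i)"
      "\<And>i. i \<in> {1..l} \<Longrightarrow> dot E c (z i) = opt_value E K c (S i)"
    by metis
  have "(\<Inter>i\<in>{1..l}. supp E (z i)) \<inter> J = {}"
  proof (rule ccontr)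
    assume "(\<Inter>i\<in>{1..l}. supp E (z i)) \<inter> J \<noteq> {}"
    then obtain e where e: "e \<in> J" "\<And>i. i \<in> {1..l} \<Longrightarrow> e \<in> supp E (z i)" by blast
    then obtain i where "i \<in> {1..l}" "e \<in> S i" using cover by blast
    then show False using z(1)[of i] e(2)[of i] unfolding zero_on_def supp_def by auto
  qed
  moreover have "\<forall>i\<in>{1..l}. z i \<in> truncation E K" using z(1) unfolding zero_on_def by blast
  ultimately have "(\<Sum>i\<in>{1..l}. dot E c (z i)) \<le> \<alpha> * (real l - 1)"
    using J unfolding B_fam_def by blast
  then show ?thesis using z(2) by simp
qed

text \<open>
  Given points without common support in \<open>J\<close>, let \<open>h e\<close> be an index of a point that vanishes at \<open>e\<close>.
  Each point is then feasible for the prescribed zeros in its class of \<open>h\<close>.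
\<close>

lemma B_famI:
  assumes cone: "cone_instance E K" and "J \<subseteq> E"
    and sum: "\<And>h. h ` J \<subseteq> {1..l} \<Longrightarrow> (\<Sum>i\<in>{1..l}. opt_value E K c {e \<in> J. h e = i}) \<le> \<alpha> * (real l - 1)"
  shows "J \<in> B_fam l E (truncation E K) c \<alpha>"
  unfolding B_fam_def
proof (intro CollectI conjI allI impI)
  fix z :: "nat \<Rightarrow> nat \<Rightarrow> real"
  assume z: "\<forall>i\<in>{1..l}. z i \<in> truncation E K" and disj: "(\<Inter>i\<in>{1..l}. supp E (z i)) \<inter> J = {}"
  have "\<exists>i\<in>{1..l}. z i e = 0" if e: "e \<in> J" for e
  proof -
    obtain i where i: "i \<in> {1..l}" "e \<notin> supp E (z i)" using disj e by blast
    have "z i \<in> E \<rightarrow>\<^sub>E {0..1}" using z i(1) by (auto simp: truncation_def)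
    then have "0 \<le> z i e" using e \<open>J \<subseteq> E\<close> by (auto simp: PiE_def Pi_def)
    then show ?thesis using i e \<open>J \<subseteq> E\<close> by (auto simp: supp_def intro!: bexI[of _ i])
  qed
  then obtain h where h: "\<And>e. e \<in> J \<Longrightarrow> h e \<in> {1..l}" "\<And>e. e \<in> J \<Longrightarrow> z (h e) e = 0" by metis
  have "(\<Sum>i\<in>{1..l}. dot E c (z i)) \<le> (\<Sum>i\<in>{1..l}. opt_value E K c {e \<in> J. h e = i})"
  proof (rule sum_mono)
    fix i assume "i \<in> {1..l}"
    then have "z i \<in> zero_on (truncation E K) {e \<in> J. h e = i}"
      using z h(2) unfolding zero_on_def by auto
    moreover have "{e \<in> J. h e = i} \<subseteq> E" using \<open>J \<subseteq> E\<close> by auto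
    ultimately show "dot E c (z i) \<le> opt_value E K c {e \<in> J. h e = i}"
      using is_max_opt_value[OF cone] unfolding is_max_def by blast
  qed
  also have "\<dots> \<le> \<alpha> * (real l - 1)" by (rule sum) (use h(1) in auto)
  finally show "(\<Sum>i\<in>{1..l}. dot E c (z i)) \<le> \<alpha> * (real l - 1)" .
qed (use assms in auto)

text \<open>
  In this form \<open>l\<close> only restricts the range of \<open>h\<close>: the sum runs over the nonempty classes, since an
  empty class has loss \<open>\<alpha> - v({}) = 0\<close>.
\<close>

lemma B_fam_iff_total_loss:
  assumes cone: "cone_instance E K" and max: "is_max (truncation E K) (dot E c) \<alpha>"
    and "J \<subseteq> E"
  shows "J \<in> B_fam l E (truncation E K) c \<alpha> \<longleftrightarrow>
    (\<forall>h. h ` J \<subseteq> {1..l} \<longrightarrow> \<alpha> \<le> (\<Sum>i\<in>h ` J. \<alpha> - opt_value E K c {e \<in> J. h e = i}))"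
proof -
  have "finite J" using cone \<open>J \<subseteq> E\<close> unfolding cone_instance_def using finite_subset by auto
  have *: "(\<Sum>i\<in>{1..l}. opt_value E K c {e \<in> J. h e = i}) \<le> \<alpha> * (real l - 1) \<longleftrightarrow>
      \<alpha> \<le> (\<Sum>i\<in>h ` J. \<alpha> - opt_value E K c {e \<in> J. h e = i})" if h: "h ` J \<subseteq> {1..l}" for h
  proof -
    have eq: "(\<Sum>i\<in>h ` J. \<alpha> - opt_value E K c {e \<in> J. h e = i}) = (\<Sum>i\<in>{1..l}. \<alpha> - opt_value E K c {e \<in> J. h e = i})"
    proof (rule sum.mono_neutral_left)
      show "\<forall>i\<in>{1..l} - h ` J. \<alpha> - opt_value E K c {e \<in> J. h e = i} = 0"
      proof
        fix i assume "i \<in> {1..l} - h ` J"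
        then have "{e \<in> J. h e = i} = {}" by auto
        then show "\<alpha> - opt_value E K c {e \<in> J. h e = i} = 0"
            using opt_value_empty[OF max] by (simp only: diff_self)
      qed
    qed (use h in auto)
    have "(\<Sum>i\<in>{1..l}. \<alpha> - opt_value E K c {e \<in> J. h e = i}) =
        \<alpha> * real l - (\<Sum>i\<in>{1..l}. opt_value E K c {e \<in> J. h e = i})"
      by (simp add: sum_subtractf)
    then show ?thesis unfolding eq by (auto simp: right_diff_distrib)
  qed
  show ?thesis
  proof
    assume J: "J \<in> B_fam l E (truncation E K) c \<alpha>"
    show "\<forall>h. h ` J \<subseteq> {1..l} \<longrightarrow> \<alpha> \<le> (\<Sum>i\<in>h ` J. \<alpha> - opt_value E K c {e \<in> J. h e = i})"
    proof (intro allI impI)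
      fix h assume h: "h ` J \<subseteq> {1..l}"
      have "(\<Sum>i\<in>{1..l}. opt_value E K c {e \<in> J. h e = i}) \<le> \<alpha> * (real l - 1)"
        by (rule B_fam_cover[OF cone J]) (use h \<open>J \<subseteq> E\<close> in auto)
      then show "\<alpha> \<le> (\<Sum>i\<in>h ` J. \<alpha> - opt_value E K c {e \<in> J. h e = i})" using *[OF h] by simp
    qed
  next
    assume "\<forall>h. h ` J \<subseteq> {1..l} \<longrightarrow> \<alpha> \<le> (\<Sum>i\<in>h ` J. \<alpha> - opt_value E K c {e \<in> J. h e = i})"
    then show "J \<in> B_fam l E (truncation E K) c \<alpha>"
      using B_famI[OF cone \<open>J \<subseteq> E\<close>, of l c \<alpha>] * by simp
  qed
qed

lemma empty_notin_B_fam: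
  assumes "cone_instance E K" and "is_max (truncation E K) (dot E c) \<alpha>" and "\<alpha> > 0"
  shows "{} \<notin> B_fam l E (truncation E K) c \<alpha>"
  using B_fam_iff_total_loss[OF assms(1,2), of "{}" l] assms(3) by auto

text \<open>
  A map on \<open>J\<close> has at most \<open>|J|\<close> values, which can be renamed injectively to \<open>1, \<dots>, |J|\<close>.  The classes,
  and thus the total loss, remain the same.
\<close>

lemma B_inf_iff_B_fam_card:
  assumes cone: "cone_instance E K" and max: "is_max (truncation E K) (dot E c) \<alpha>"
    and J: "J \<subseteq> E" "J \<noteq> {}"
  shows "J \<in> B_inf E (truncation E K) c \<alpha> \<longleftrightarrow> J \<in> B_fam (card J) E (truncation E K) c \<alpha>"
proof
  have fin: "finite J" using cone J unfolding cone_instance_def using finite_subset by auto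
  then have "1 \<le> card J" using J by (simp add: Suc_le_eq card_gt_0_iff)
  then show "J \<in> B_inf E (truncation E K) c \<alpha> \<Longrightarrow> J \<in> B_fam (card J) E (truncation E K) c \<alpha>"
    unfolding B_inf_def by auto
  assume "J \<in> B_fam (card J) E (truncation E K) c \<alpha>"
  then have k: "\<alpha> \<le> (\<Sum>i\<in>h ` J. \<alpha> - opt_value E K c {e \<in> J. h e = i})" if "h ` J \<subseteq> {1..card J}" for h
    using B_fam_iff_total_loss[OF cone max J(1)] that by blast
  have "J \<in> B_fam l E (truncation E K) c \<alpha>" for l
    unfolding B_fam_iff_total_loss[OF cone max J(1)]
  proof (intro allI impI)
    fix h :: "nat \<Rightarrow> nat"
    have "card (h ` J) \<le> card {1..card J}" using card_image_le[OF fin] by simp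
    then obtain g where g: "inj_on g (h ` J)" "g ` h ` J \<subseteq> {1..card J}"
      using card_le_inj[of "h ` J" "{1..card J}"] fin by auto
    have "\<alpha> \<le> (\<Sum>i\<in>(g \<circ> h) ` J. \<alpha> - opt_value E K c {e \<in> J. (g \<circ> h) e = i})"
      by (rule k) (use g(2) in \<open>simp add: image_comp\<close>)
    also have "\<dots> = (\<Sum>i\<in>h ` J. \<alpha> - opt_value E K c {e \<in> J. (g \<circ> h) e = g i})"
      unfolding image_comp[symmetric] by (rule sum.reindex_cong[OF g(1)]) auto
    also have "\<dots> = (\<Sum>i\<in>h ` J. \<alpha> - opt_value E K c {e \<in> J. h e = i})"
    proof (rule sum.cong)
      fix i assume "i \<in> h ` J"
      then have "{e \<in> J. (g \<circ> h) e = g i} = {e \<in> J. h e = i}" using g(1) by (auto dest: inj_onD)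
      then show "\<alpha> - opt_value E K c {e \<in> J. (g \<circ> h) e = g i} = \<alpha> - opt_value E K c {e \<in> J. h e = i}" by simp
    qed simp
    finally show "\<alpha> \<le> (\<Sum>i\<in>h ` J. \<alpha> - opt_value E K c {e \<in> J. h e = i})" .
  qed
  then show "J \<in> B_inf E (truncation E K) c \<alpha>" unfolding B_inf_def by auto
qed

section \<open>Enumerating the partitions\<close>

text \<open>
  A partial partition consists of the closed parts \<open>P\<close>, the part \<open>A\<close> being built, the elements \<open>R\<close> still
  to be decided for it, the elements \<open>N\<close> already left to later parts, and a list \<open>L\<close> whose length is the
  number of later parts.  The result lists all full partitions extending it.  All decisions are local
  to the heads of these lists, so that the search program needs no inner loops.
\<close>

fun completions ::
  "'a list \<Rightarrow> 'a list \<Rightarrow> 'a list \<Rightarrow> 'a list list \<Rightarrow> 'b list \<Rightarrow> 'a list list list" where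
  "completions (e # R) N A P L = completions R N (e # A) P L @ completions R (e # N) A P L"
| "completions [] N A P (u # L) = completions N [] [] (A # P) L"
| "completions [] [] A P [] = [A # P]"
| "completions [] (e # N) A P [] = []"

text \<open>
  Each element of \<open>R\<close> has the current part and the \<open>|L|\<close> later ones to choose from, each element of \<open>N\<close>
  only the later ones.  In particular, \<open>0 ^ 0 = 1\<close> counts the complete partition, and \<open>0 ^ n = 0\<close> a dead end in
  which elements are left over after the last part.
\<close>

lemma length_completions:
  "length (completions R N A P L) = (length L + 1) ^ length R * length L ^ length N"
  by (induction R N A P L rule: completions.induct) (simp_all add: algebra_simps)

lemma completions_sound:
  "Q \<in> set (completions R N A P L) \<Longrightarrow> length Q = Suc (length P + length L) \<and>
    mset (concat Q) = mset R + mset N + mset A + mset (concat P)"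
  by (induction R N A P L rule: completions.induct) auto

text \<open>
  The map \<open>h\<close> prescribes the part of each element relative to the current one, which has number 0.
  Closing a part decreases all numbers by 1.  Only the values \<open>w\<close> of the parts are tracked.
\<close>

lemma completions_complete:
  fixes w :: "'a set \<Rightarrow> real" and L :: "'b list"
  assumes "\<And>e. e \<in> set R \<Longrightarrow> h e \<le> length L" and "\<And>e. e \<in> set N \<Longrightarrow> 1 \<le> h e \<and> h e \<le> length L"
  shows "\<exists>Q\<in>set (completions R N A P L). (\<Sum>B\<leftarrow>Q. w (set B)) =
    (\<Sum>B\<leftarrow>P. w (set B)) + w (set A \<union> {e \<in> set R. h e = 0}) +
    (\<Sum>i\<in>{1..length L}. w {e \<in> set R \<union> set N. h e = i})"
  using assms
proof (induction R N A P L arbitrary: h rule: completions.induct)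
  case (1 e R N A P L)
  show ?case
  proof (cases "h e = 0")
    case True
    obtain Q where Q: "Q \<in> set (completions R N (e # A) P L)" and
      eq: "(\<Sum>B\<leftarrow>Q. w (set B)) =
        (\<Sum>B\<leftarrow>P. w (set B)) + w (set (e # A) \<union> {e \<in> set R. h e = 0}) +
        (\<Sum>i\<in>{1..length L}. w {e \<in> set R \<union> set N. h e = i})"
      using "1.IH"(1)[of h] "1.prems" by auto
    have 1: "set (e # A) \<union> {e \<in> set R. h e = 0} = set A \<union> {e' \<in> set (e # R). h e' = 0}"
      using True by auto
    have 2: "(\<Sum>i\<in>{1..length L}. w {e \<in> set R \<union> set N. h e = i}) =
        (\<Sum>i\<in>{1..length L}. w {e' \<in> set (e # R) \<union> set N. h e' = i})"
      by (intro sum.cong refl arg_cong[of _ _ w]) (use True in auto)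
    have "Q \<in> set (completions (e # R) N A P L)" using Q by simp
    then show ?thesis by (rule bexI[rotated]) (simp only: eq 1 2)
  next
    case False
    obtain Q where Q: "Q \<in> set (completions R (e # N) A P L)" and
      eq: "(\<Sum>B\<leftarrow>Q. w (set B)) =
        (\<Sum>B\<leftarrow>P. w (set B)) + w (set A \<union> {e \<in> set R. h e = 0}) +
        (\<Sum>i\<in>{1..length L}. w {e' \<in> set R \<union> set (e # N). h e' = i})"
      using "1.IH"(2)[of h] "1.prems" False by (auto simp: Suc_le_eq)
    have 1: "{e \<in> set R. h e = 0} = {e' \<in> set (e # R). h e' = 0}"
      using False by auto
    have 2: "set R \<union> set (e # N) = set (e # R) \<union> set N" by auto
    have "Q \<in> set (completions (e # R) N A P L)" using Q by simp
    then show ?thesis by (rule bexI[rotated]) (simp only: eq 1 2)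
  qed
next
  case (2 N A P u L)
  have IH: "\<exists>Q\<in>set (completions N [] [] (A # P) L). (\<Sum>B\<leftarrow>Q. w (set B)) =
    (\<Sum>B\<leftarrow>A # P. w (set B)) + w (set [] \<union> {e \<in> set N. h e - 1 = 0}) +
    (\<Sum>i\<in>{1..length L}. w {e \<in> set N \<union> set []. h e - 1 = i})"
    by (rule "2.IH") (use "2.prems" in \<open>force+\<close>)
  have shift: "{e \<in> set N. h e - 1 = i} = {e \<in> set N. h e = Suc i}" for i
    using "2.prems"(2) by fastforce
  have split: "(\<Sum>i\<in>{1..Suc (length L)}. w {e \<in> set N. h e = i}) =
      w {e \<in> set N. h e = Suc 0} + (\<Sum>i\<in>{1..length L}. w {e \<in> set N. h e = Suc i})"
    by (simp only: One_nat_def sum.atLeast_Suc_atMost_Suc_shift comp_def)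
      (simp add: sum.atLeast_Suc_atMost[of 0])
  show ?case
    using IH unfolding list.set Un_empty_right Un_empty_left shift length_Cons empty_iff
      split list.map sum_list.Cons completions.simps
    by (simp add: add_ac)
next
  case (4 e N A P)
  show ?case using "4.prems"(2)[of e] by auto
qed auto

text \<open>
  The enumeration only yields partitions with \<open>j\<close> in the first part.  For the remaining ones, the
  indices \<open>1\<close> and \<open>h j\<close> are interchanged, which permutes the parts and does not change the sum.
\<close>

lemma B_fam_iff_completions:
  fixes L :: "'b list"
  assumes cone: "cone_instance E K" and max: "is_max (truncation E K) (dot E c) \<alpha>"
    and js: "distinct (j # js)" "set (j # js) \<subseteq> E" and L: "length L = l - 1" and "l \<ge> 1"
  shows "set (j # js) \<in> B_fam l E (truncation E K) c \<alpha> \<longleftrightarrow>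
    (\<forall>Q\<in>set (completions js [] [j] [] L). (\<Sum>B\<leftarrow>Q. opt_value E K c (set B)) \<le> \<alpha> * (real l - 1))"
    (is "?J \<in> ?B \<longleftrightarrow> ?C")
proof
  assume J: "?J \<in> ?B"
  show ?C
  proof
    fix Q assume Q: "Q \<in> set (completions js [] [j] [] L)"
    have len: "length Q = l" and ms: "mset (concat Q) = mset (j # js)"
      using completions_sound[OF Q] L \<open>l \<ge> 1\<close> by auto
    have U: "\<Union> (set ` set Q) = ?J" using arg_cong[OF ms, of set_mset] by auto
    have "(\<Sum>B\<leftarrow>Q. opt_value E K c (set B)) = (\<Sum>i<l. opt_value E K c (set (Q ! i)))"
      using len by (simp add: sum_list_sum_nth atLeast0LessThan)
    also have "\<dots> = (\<Sum>i\<in>{1..l}. opt_value E K c (set (Q ! (i - 1))))"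
      by (rule sum.reindex_bij_witness[of _ "\<lambda>i. i - 1" Suc]) auto
    also have "\<dots> \<le> \<alpha> * (real l - 1)"
    proof (rule B_fam_cover[OF cone J])
      show "?J \<subseteq> (\<Union>i\<in>{1..l}. set (Q ! (i - 1)))"
      proof
        fix e assume "e \<in> ?J"
        then obtain i where "i < l" "e \<in> set (Q ! i)" using U len by (metis UN_E in_set_conv_nth)
        then show "e \<in> (\<Union>i\<in>{1..l}. set (Q ! (i - 1)))" by (intro UN_I[of "Suc i"]) auto
      qed
      fix i assume "i \<in> {1..l}"
      then have "Q ! (i - 1) \<in> set Q" using len by auto
      then show "set (Q ! (i - 1)) \<subseteq> E" using U js(2) by blast
    qed
    finally show "(\<Sum>B\<leftarrow>Q. opt_value E K c (set B)) \<le> \<alpha> * (real l - 1)" .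
  qed
next
  assume C: ?C
  show "?J \<in> ?B"
  proof (rule B_famI[OF cone js(2)])
    fix h assume h: "h ` ?J \<subseteq> {1..l}"
    \<comment> \<open>The transposition of \<open>1\<close> and \<open>h j\<close>, followed by the shift of the range to \<open>0, \<dots>, l - 1\<close>.\<close>
    define \<pi> where "\<pi> i = (if i = h j then 0 else if i = 1 then h j - 1 else i - 1)" for i
    have hj: "h j \<in> {1..l}" using h by auto
    have bij: "bij_betw \<pi> {1..l} {0..length L}"
    proof (rule bij_betw_byWitness[where f' = "\<lambda>i. if i = 0 then h j else if i = h j - 1 then 1 else i + 1"])
    qed (use hj L in \<open>auto simp: \<pi>_def\<close>)
    let ?w = "opt_value E K c"
    have \<pi>h: "\<pi> (h e) \<le> length L" if "e \<in> ?J" for e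
      using bij_betwE[OF bij] h that by force
    have inj: "\<pi> (h e) = \<pi> i \<longleftrightarrow> h e = i" if "e \<in> ?J" "i \<in> {1..l}" for e i
      using bij h that by (metis bij_betw_def image_subset_iff inj_on_eq_iff)
    have "\<exists>Q\<in>set (completions js [] [j] [] L). (\<Sum>B\<leftarrow>Q. ?w (set B)) =
      (\<Sum>B\<leftarrow>[]. ?w (set B)) + ?w (set [j] \<union> {e \<in> set js. \<pi> (h e) = 0}) +
      (\<Sum>i\<in>{1..length L}. ?w {e \<in> set js \<union> set []. \<pi> (h e) = i})"
      by (rule completions_complete) (use \<pi>h in auto)
    moreover have "set [j] \<union> {e \<in> set js. \<pi> (h e) = 0} = {e \<in> ?J. \<pi> (h e) = 0}"
      by (auto simp: \<pi>_def)
    moreover have "(\<Sum>i\<in>{1..length L}. ?w {e \<in> set js \<union> set []. \<pi> (h e) = i}) =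
        (\<Sum>i\<in>{1..length L}. ?w {e \<in> ?J. \<pi> (h e) = i})"
      by (intro sum.cong refl arg_cong[of _ _ ?w]) (auto simp: \<pi>_def)
    ultimately obtain Q where Q: "Q \<in> set (completions js [] [j] [] L)" and
      sumQ: "(\<Sum>B\<leftarrow>Q. ?w (set B)) = ?w {e \<in> ?J. \<pi> (h e) = 0} + (\<Sum>i\<in>{1..length L}. ?w {e \<in> ?J. \<pi> (h e) = i})"
      by (simp only: list.map sum_list.Nil add_0) blast
    have "(\<Sum>i\<in>{1..l}. ?w {e \<in> ?J. h e = i}) = (\<Sum>i\<in>{1..l}. ?w {e \<in> ?J. \<pi> (h e) = \<pi> i})"
      using inj by (intro sum.cong refl arg_cong[of _ _ ?w]) blast
    also have "\<dots> = (\<Sum>i\<in>{0..length L}. ?w {e \<in> ?J. \<pi> (h e) = i})"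
      by (rule sum.reindex_bij_betw[OF bij])
    also have "\<dots> = (\<Sum>B\<leftarrow>Q. ?w (set B))"
      unfolding sumQ by (simp add: sum.atLeast_Suc_atMost[of 0])
    also have "\<dots> \<le> \<alpha> * (real l - 1)" using C Q by blast
    finally show "(\<Sum>i\<in>{1..l}. ?w {e \<in> ?J. h e = i}) \<le> \<alpha> * (real l - 1)" .
  qed
qed

section \<open>The search program\<close>

definition parts_code :: "val \<Rightarrow> nat list list \<Rightarrow> val" where
  "parts_code obj Q = list_code (map (\<lambda>A. Pair obj (set_code A)) Q)"

type_synonym task = "nat list \<times> nat list \<times> nat list \<times> nat list list \<times> val list"

text \<open>
  The current part \<open>A\<close> is stored as the head of the list of parts, so that a finished task contains the
  code of a product program as it stands.
\<close>

definition task_code :: "val \<Rightarrow> task \<Rightarrow> val" where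
  "task_code obj = (\<lambda>(R, N, A, P, L).
     Pair (Pair (set_code R) (set_code N)) (Pair (parts_code obj (A # P)) (list_code L)))"

text \<open>
  Besides the stack of open tasks and the answer so far, the state carries the description \<open>d\<close> that
  the evaluating subprogram may need and the number \<open>rhs\<close> to compare with.
\<close>

definition state_code :: "val \<Rightarrow> val \<Rightarrow> real \<Rightarrow> task list \<times> bool \<Rightarrow> val" where
  "state_code d obj rhs = (\<lambda>(stack, ans).
     Pair (Pair d (Num rhs)) (Pair (list_code (map (task_code obj) stack)) (bool_code ans)))"

text \<open>
  Access to the components of the topmost task in a state.
\<close>

definition task_at :: "opr list \<Rightarrow> prog" where
  "task_at fs = path ([Right, Left, Left] @ fs)"

abbreviation empty_prog :: prog where "empty_prog \<equiv> Op MkEmpty"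

abbreviation stack_rest :: prog where "stack_rest \<equiv> path [Right, Left, Right]"

text \<open>
  The head of \<open>R\<close> joins the current part in one copy of the task and is deferred to \<open>N\<close> in the other.
\<close>

definition branch_prog :: prog where
  "branch_prog = Fork (Op Left) (Fork
     (Fork
        (Fork (Fork (task_at [Left, Left, Right]) (task_at [Left, Right]))
              (Fork (Fork (Fork (task_at [Right, Left, Left, Left])
                                (Fork (task_at [Left, Left, Left]) (task_at [Right, Left, Left, Right])))
                          (task_at [Right, Left, Right]))
                    (task_at [Right, Right])))
     (Fork
        (Fork (Fork (task_at [Left, Left, Right]) (Fork (task_at [Left, Left, Left]) (task_at [Left, Right])))
              (task_at [Right]))
        stack_rest))
     (path [Right, Right]))"

definition close_part_prog :: prog where
  "close_part_prog = Fork (Op Left) (Fork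
     (Fork
        (Fork (Fork (task_at [Left, Right]) empty_prog)
              (Fork (Fork (Fork (task_at [Right, Left, Left, Left]) empty_prog) (task_at [Right, Left]))
                    (task_at [Right, Right, Right])))
        stack_rest)
     (path [Right, Right]))"

definition drop_prog :: prog where
  "drop_prog = Fork (Op Left) (Fork stack_rest (path [Right, Right]))"

definition test_prog :: "prog \<Rightarrow> prog" where
  "test_prog S = Fork (Op Left) (Fork stack_rest
     (Cond (Fork (Fork (path [Left, Left]) (task_at [Right, Left]) ;; S) (path [Left, Right]) ;; Op Leq)
        (path [Right, Right]) empty_prog))"

definition step_prog :: "prog \<Rightarrow> prog" where
  "step_prog S = Cond (task_at [Left, Left, IsPair]) branch_prog
     (Cond (task_at [Right, Right, IsPair]) close_part_prog
     (Cond (task_at [Left, Right, IsPair]) drop_prog (test_prog S)))"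

text \<open>
  The value of the product with a single factor and no prescribed zeros, which is \<open>\<alpha>\<close>.  The first
  component of the input is an entry of the list that controls the summation in \<open>rhs_prog\<close>.
\<close>

definition alpha_prog :: "prog \<Rightarrow> prog" where
  "alpha_prog S = Fork (path [Right, Left]) (Fork (Fork (path [Right, Right, Left]) empty_prog) empty_prog) ;; S"

definition rhs_prog :: "prog \<Rightarrow> prog \<Rightarrow> prog" where
  "rhs_prog S M = Fork M (Op Ident) ;; sum_prog (alpha_prog S)"

text \<open>
  The program \<open>M\<close> computes a list of length \<open>l - 1\<close>, which serves as a unary number.  In the initial
  task the first element of \<open>J\<close> is already in the first part.
\<close>

definition start_prog :: "prog \<Rightarrow> prog" where
  "start_prog M = Fork
     (Fork (Fork (path [Right, Right, Right]) empty_prog)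
           (Fork (Fork (Fork (path [Right, Left]) (Fork (path [Right, Right, Left]) empty_prog)) empty_prog)
                 M))
     empty_prog"

text \<open>
  The input is \<open>(d, (c, J))\<close>.  Empty sets \<open>J\<close> are rejected at once; in the case \<open>l = |J|\<close> there would be
  no factor to query for them.
\<close>

definition search_prog :: "prog \<Rightarrow> prog \<Rightarrow> prog" where
  "search_prog S M = Cond (path [Right, Right, IsPair])
     (Fork (Fork (Op Left) (rhs_prog S M)) (Fork (start_prog M) (Op MkOne)) ;;
      While (path [Right, Left, IsPair]) (step_prog S) ;; path [Right, Right])
     empty_prog"

text \<open>
  Bounds the number of steps that a task causes when \<open>|R| + |N| \<le> n\<close>.  Branching shortens \<open>R\<close>, and
  \<open>2 * 3 ^ (r - 1) < 3 ^ r\<close>.  Closing a part turns \<open>N\<close>, of length at most \<open>n\<close>, into the new \<open>R\<close>, which is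
  outweighed by the loss of one entry of \<open>L\<close>.
\<close>

definition task_weight :: "nat \<Rightarrow> task \<Rightarrow> nat" where
  "task_weight n = (\<lambda>(R, N, A, P, L). 3 ^ (length R + Suc n * length L))"

definition task_leaves :: "task \<Rightarrow> nat list list list" where
  "task_leaves = (\<lambda>(R, N, A, P, L). completions R N A P L)"

text \<open>
  The summand 4 is for \<open>test_prog\<close>, which removes a task and writes an answer of size at most 3.
\<close>

definition growth :: nat where
  "growth = cost_factor branch_prog + cost_factor close_part_prog + cost_factor drop_prog + 4"

lemma arith_free_size:
  assumes "loop_free p" and "arith_free p"
  shows "vsize (loop_free_value p x) \<le> cost_factor p * vsize x"
proof -
  obtain t where "exec (\<lambda>_ _. False) p x (loop_free_value p x) t 0" using exec_loop_free[OF assms(1)] by blast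
  then show ?thesis
    using arith_free_time[OF assms(2)] exec_output_size by (meson le_trans)
qed

lemma set_code_simps [simp]:
  "set_code [] = Empty" "set_code (e # A) = Pair (Num (real e)) (set_code A)"
  by (simp_all add: set_code_def)

lemma parts_code_simps [simp]:
  "parts_code obj [] = Empty"
  "parts_code obj (A # Q) = Pair (Pair obj (set_code A)) (parts_code obj Q)"
  by (simp_all add: parts_code_def)

text \<open>
  The subprogram \<open>S\<close> evaluates products of at most \<open>l\<close> factors with disjoint sets of prescribed zeros
  at the cost of one query, and in polynomial time if time is counted.
\<close>

locale product_search =
  fixes orc :: "val \<Rightarrow> val \<Rightarrow> bool" and timed :: bool and S :: prog and d obj :: val
    and w :: "nat set \<Rightarrow> real" and js :: "nat list" and l C k :: nat
  assumes evaluates: "\<And>Q. length Q \<le> l \<Longrightarrow> distinct (concat Q) \<Longrightarrow> set (concat Q) \<subseteq> set js \<Longrightarrow>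
      runs_in orc timed S (Pair d (parts_code obj Q)) (Num (\<Sum>B\<leftarrow>Q. w (set B)))
        (C * vsize (Pair d (parts_code obj Q)) ^ k) 1"
    and distinct_js: "distinct js"
begin

definition good_task :: "task \<Rightarrow> bool" where
  "good_task = (\<lambda>(R, N, A, P, L). mset R + mset N + mset A + mset (concat P) = mset js \<and>
     Suc (length P + length L) = l)"

abbreviation passes :: "real \<Rightarrow> nat list list \<Rightarrow> bool" where
  "passes rhs Q \<equiv> (\<Sum>B\<leftarrow>Q. w (set B)) \<le> rhs"

text \<open>
  Twice the time of \<open>S\<close>, because the number returned by \<open>S\<close> is read again by the comparison.
\<close>

definition step_time :: "nat \<Rightarrow> nat" where
  "step_time n = (200000 + growth) * n + 2 * (C * n ^ k)"

text \<open>
  One step replaces the topmost task by tasks with the same leaves in total, or tests its only leaf.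
  So the conjunction of the answer so far with all tests still to come is invariant, and the number
  of leaves is a potential that pays for the queries.
\<close>

lemma step_correct:
  assumes good: "\<And>T. T \<in> set (T0 # stack) \<Longrightarrow> good_task T"
  shows "\<exists>stack' ans' q.
    runs_in orc timed (step_prog S) (state_code d obj rhs (T0 # stack, ans))
      (state_code d obj rhs (stack', ans'))
      (step_time (vsize (state_code d obj rhs (T0 # stack, ans)))) q \<and>
    (\<forall>T\<in>set stack'. good_task T) \<and>
    (ans' \<and> (\<forall>T\<in>set stack'. \<forall>Q\<in>set (task_leaves T). passes rhs Q) \<longleftrightarrow>
     ans \<and> (\<forall>T\<in>set (T0 # stack). \<forall>Q\<in>set (task_leaves T). passes rhs Q)) \<and>
    (\<Sum>T\<leftarrow>stack'. task_weight (length js) T) < (\<Sum>T\<leftarrow>T0 # stack. task_weight (length js) T) \<and>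
    q + (\<Sum>T\<leftarrow>stack'. length (task_leaves T)) \<le> (\<Sum>T\<leftarrow>T0 # stack. length (task_leaves T)) \<and>
    vsize (state_code d obj rhs (stack', ans')) \<le> growth * vsize (state_code d obj rhs (T0 # stack, ans))"
proof -
  obtain R N A P L where T0: "T0 = (R, N, A, P, L)" by (cases T0) auto
  have T0_good: "mset R + mset N + mset A + mset (concat P) = mset js" "Suc (length P + length L) = l"
    using good[of T0] T0 by (simp_all add: good_task_def)
  let ?x = "state_code d obj rhs (T0 # stack, ans)"
  let ?n = "vsize ?x"
  \<comment> \<open>The numerals are the cost factors of access paths: 84, 340, 5460, 21844 for 2, 3, 5, 6 operations.\<close>
  have R: "runs_in orc timed (task_at [Left, Left, IsPair]) ?x (bool_code (R \<noteq> [])) (21844 * ?n) 0"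
    by (rule runs_in_arith_free; cases R) (simp_all add: state_code_def task_code_def task_at_def T0)
  have L: "runs_in orc timed (task_at [Right, Right, IsPair]) ?x (bool_code (L \<noteq> [])) (21844 * ?n) 0"
    by (rule runs_in_arith_free; cases L) (simp_all add: state_code_def task_code_def task_at_def T0)
  have N: "runs_in orc timed (task_at [Left, Right, IsPair]) ?x (bool_code (N \<noteq> [])) (21844 * ?n) 0"
    by (rule runs_in_arith_free; cases N) (simp_all add: state_code_def task_code_def task_at_def T0)
  have R0: "runs_in orc timed (task_at [Left, Left, IsPair]) ?x Empty (21844 * ?n) 0" if "R = []"
    using R that by simp
  have L0: "runs_in orc timed (task_at [Right, Right, IsPair]) ?x Empty (21844 * ?n) 0" if "L = []"
    using L that by simp
  have N0: "runs_in orc timed (task_at [Left, Right, IsPair]) ?x Empty (21844 * ?n) 0" if "N = []"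
    using N that by simp
  consider (branch) e R' where "R = e # R'" | (close) u L' where "R = []" "L = u # L'"
    | (drop) e N' where "R = []" "L = []" "N = e # N'" | (test) "R = []" "L = []" "N = []"
    by (cases R; cases L; cases N) auto
  then show ?thesis
  proof cases
    case branch
    let ?T1 = "(R', N, e # A, P, L)" and ?T2 = "(R', e # N, A, P, L)"
    let ?y = "state_code d obj rhs (?T1 # ?T2 # stack, ans)"
    have y: "loop_free_value branch_prog ?x = ?y" and free: "loop_free branch_prog" "arith_free branch_prog"
      by (simp_all add: branch_prog_def state_code_def task_code_def task_at_def T0 branch)
    have "runs_in orc timed branch_prog ?x ?y (cost_factor branch_prog * ?n) 0"
      by (rule runs_in_arith_free[OF free y refl])
    from runs_in_Cond_true[OF R _ this] have "runs_in orc timed (step_prog S) ?x ?y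
        (?n + 21844 * ?n + cost_factor branch_prog * ?n) (0 + 0)"
      using branch by (simp add: step_prog_def)
    then have "runs_in orc timed (step_prog S) ?x ?y (step_time ?n) 0"
      by (rule runs_in_mono) (simp_all add: step_time_def growth_def algebra_simps)
    moreover have "vsize ?y \<le> growth * ?n"
      using arith_free_size[OF free, of ?x] y by (simp add: growth_def algebra_simps)
    moreover have "\<forall>T\<in>set (?T1 # ?T2 # stack). good_task T"
      using good T0_good branch by (auto simp: good_task_def add_ac)
    moreover have "(\<Sum>T\<leftarrow>?T1 # ?T2 # stack. task_weight (length js) T) <
        (\<Sum>T\<leftarrow>T0 # stack. task_weight (length js) T)"
      by (simp add: task_weight_def T0 branch)
    moreover have "0 + (\<Sum>T\<leftarrow>?T1 # ?T2 # stack. length (task_leaves T)) \<le>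
        (\<Sum>T\<leftarrow>T0 # stack. length (task_leaves T))"
      by (simp add: task_leaves_def T0 branch)
    moreover have "ans \<and> (\<forall>T\<in>set (?T1 # ?T2 # stack). \<forall>Q\<in>set (task_leaves T). passes rhs Q) \<longleftrightarrow>
        ans \<and> (\<forall>T\<in>set (T0 # stack). \<forall>Q\<in>set (task_leaves T). passes rhs Q)"
      by (auto simp: task_leaves_def T0 branch)
    ultimately show ?thesis by blast
  next
    case close
    let ?T1 = "(N, [], [], A # P, L')"
    let ?y = "state_code d obj rhs (?T1 # stack, ans)"
    have y: "loop_free_value close_part_prog ?x = ?y" and free: "loop_free close_part_prog" "arith_free close_part_prog"
      by (simp_all add: close_part_prog_def state_code_def task_code_def task_at_def T0 close)
    have "runs_in orc timed close_part_prog ?x ?y (cost_factor close_part_prog * ?n) 0"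
      by (rule runs_in_arith_free[OF free y refl])
    from runs_in_Cond_false[OF R0[OF close(1)] runs_in_Cond_true[OF L _ this]]
    have "runs_in orc timed (step_prog S) ?x ?y
        (?n + 21844 * ?n + (?n + 21844 * ?n + cost_factor close_part_prog * ?n)) (0 + (0 + 0))"
      using close unfolding step_prog_def by simp
    then have "runs_in orc timed (step_prog S) ?x ?y (step_time ?n) 0"
      by (rule runs_in_mono) (simp_all add: step_time_def growth_def algebra_simps)
    moreover have "vsize ?y \<le> growth * ?n"
      using arith_free_size[OF free, of ?x] y by (simp add: growth_def algebra_simps)
    moreover have "\<forall>T\<in>set (?T1 # stack). good_task T"
      using good T0_good close by (auto simp: good_task_def add_ac)
    moreover have "(\<Sum>T\<leftarrow>?T1 # stack. task_weight (length js) T) <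
        (\<Sum>T\<leftarrow>T0 # stack. task_weight (length js) T)"
    proof -
      have "length N \<le> length js" using arg_cong[OF T0_good(1), of size] by simp
      then have "(3::nat) ^ (length N + Suc (length js) * length L') <
          3 ^ (length R + Suc (length js) * length L)"
        by (intro power_strict_increasing) (simp_all add: close)
      then show ?thesis by (simp add: task_weight_def T0 del: mult_Suc power_strict_increasing_iff)
    qed
    moreover have "0 + (\<Sum>T\<leftarrow>?T1 # stack. length (task_leaves T)) \<le>
        (\<Sum>T\<leftarrow>T0 # stack. length (task_leaves T))"
      by (simp add: task_leaves_def T0 close)
    moreover have "ans \<and> (\<forall>T\<in>set (?T1 # stack). \<forall>Q\<in>set (task_leaves T). passes rhs Q) \<longleftrightarrow>
        ans \<and> (\<forall>T\<in>set (T0 # stack). \<forall>Q\<in>set (task_leaves T). passes rhs Q)"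
      by (auto simp: task_leaves_def T0 close)
    ultimately show ?thesis by blast
  next
    case drop
    let ?y = "state_code d obj rhs (stack, ans)"
    have y: "loop_free_value drop_prog ?x = ?y" and free: "loop_free drop_prog" "arith_free drop_prog"
      by (simp_all add: drop_prog_def state_code_def task_code_def task_at_def T0 drop)
    have "runs_in orc timed drop_prog ?x ?y (cost_factor drop_prog * ?n) 0"
      by (rule runs_in_arith_free[OF free y refl])
    from runs_in_Cond_false[OF R0[OF drop(1)] runs_in_Cond_false[OF L0[OF drop(2)] runs_in_Cond_true[OF N _ this]]]
    have "runs_in orc timed (step_prog S) ?x ?y
        (?n + 21844 * ?n + (?n + 21844 * ?n + (?n + 21844 * ?n + cost_factor drop_prog * ?n))) (0 + (0 + (0 + 0)))"
      using drop unfolding step_prog_def by simp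
    then have "runs_in orc timed (step_prog S) ?x ?y (step_time ?n) 0"
      by (rule runs_in_mono) (simp_all add: step_time_def growth_def algebra_simps)
    moreover have "vsize ?y \<le> growth * ?n"
      using arith_free_size[OF free, of ?x] y by (simp add: growth_def algebra_simps)
    moreover have "(\<Sum>T\<leftarrow>stack. task_weight (length js) T) <
        (\<Sum>T\<leftarrow>T0 # stack. task_weight (length js) T)"
      by (simp add: task_weight_def T0)
    moreover have "ans \<and> (\<forall>T\<in>set stack. \<forall>Q\<in>set (task_leaves T). passes rhs Q) \<longleftrightarrow>
        ans \<and> (\<forall>T\<in>set (T0 # stack). \<forall>Q\<in>set (task_leaves T). passes rhs Q)"
      by (auto simp: task_leaves_def T0 drop)
    moreover have "0 + (\<Sum>T\<leftarrow>stack. length (task_leaves T)) \<le>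
        (\<Sum>T\<leftarrow>T0 # stack. length (task_leaves T))"
      by simp
    moreover have "\<forall>T\<in>set stack. good_task T" using good by simp
    ultimately show ?thesis by blast
  next
    case test
    let ?v = "\<Sum>B\<leftarrow>A # P. w (set B)"
    let ?in = "Pair d (parts_code obj (A # P))"
    let ?ans = "ans \<and> passes rhs (A # P)"
    let ?y = "state_code d obj rhs (stack, ?ans)"
    let ?t = "C * vsize ?in ^ k"
    have ms: "mset (concat (A # P)) = mset js" using T0_good(1) test by simp
    have eval: "runs_in orc timed S ?in (Num ?v) ?t 1"
    proof (rule evaluates)
      show "length (A # P) \<le> l" using T0_good(2) test by simp
      show "distinct (concat (A # P))" using mset_eq_imp_distinct_iff[OF ms] distinct_js by simp
      show "set (concat (A # P)) \<subseteq> set js" using mset_eq_setD[OF ms] by simp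
    qed
    have p: "runs_in orc timed (Op Left) ?x (Pair d (Num rhs)) (4 * ?n) 0"
      "runs_in orc timed stack_rest ?x (list_code (map (task_code obj) stack)) (340 * ?n) 0"
      "runs_in orc timed (path [Left, Left]) ?x d (84 * ?n) 0"
      "runs_in orc timed (task_at [Right, Left]) ?x (parts_code obj (A # P)) (5460 * ?n) 0"
      "runs_in orc timed (path [Left, Right]) ?x (Num rhs) (84 * ?n) 0"
      "runs_in orc timed (path [Right, Right]) ?x (bool_code ans) (84 * ?n) 0"
      "runs_in orc timed empty_prog ?x Empty (4 * ?n) 0"
      by (rule runs_in_arith_free; simp add: state_code_def task_code_def task_at_def T0)+
    have p7: "runs_in orc timed empty_prog ?x Empty (84 * ?n) 0"
      by (rule runs_in_mono[OF p(7)]) simp_all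
    define b where "b \<longleftrightarrow> ?v \<le> rhs"
    have leq: "runs_in orc timed (Op Leq) (Pair (Num ?v) (Num rhs)) (bool_code b)
        (vsize (Pair (Num ?v) (Num rhs)) + 3) 0"
      by (rule runs_in_mono[OF runs_in_Op]) (simp_all add: b_def vsize_bool_code del: bool_code_eq)
    note cmp = runs_in_Then[OF runs_in_Fork[OF runs_in_Then[OF runs_in_Fork[OF p(3,4)] eval] p(5)] leq]
    have "runs_in orc timed (Cond (Fork (Fork (path [Left, Left]) (task_at [Right, Left]) ;; S) (path [Left, Right]) ;; Op Leq)
        (path [Right, Right]) empty_prog) ?x (bool_code ?ans)
        (?n + (?n + (?n + 84 * ?n + 5460 * ?n + ?t) + 84 * ?n +
          (vsize (Pair (Num ?v) (Num rhs)) + 3)) + 84 * ?n) (0 + 0 + 1 + 0 + 0 + 0)"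
    proof (cases b)
      case True
      then have "?ans = ans" using b_def by simp
      then show ?thesis using runs_in_Cond_true[OF cmp _ p(6)] True by (simp only:) simp
    next
      case False
      then have "bool_code ?ans = Empty" "bool_code b = Empty" using b_def by simp_all
      then show ?thesis using runs_in_Cond_false[OF cmp[unfolded \<open>bool_code b = Empty\<close>] p7]
        by (simp only:)
    qed
    from runs_in_Fork[OF p(1) runs_in_Fork[OF p(2) this]]
    have tp: "runs_in orc timed (test_prog S) ?x ?y
      (?n + 4 * ?n + (?n + 340 * ?n + (?n + (?n + (?n + 84 * ?n + 5460 * ?n + ?t) + 84 * ?n +
          (vsize (Pair (Num ?v) (Num rhs)) + 3)) + 84 * ?n)))
      (0 + (0 + (0 + 0 + 1 + 0 + 0 + 0)))"
      unfolding test_prog_def by (simp only: state_code_def prod.case)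
    have tp': "runs_in orc timed (test_prog S) ?x ?y (10000 * ?n + 2 * ?t) 1"
    proof (rule runs_in_mono[OF tp])
      assume timed
      have "vsize (Num ?v) \<le> ?t" by (rule runs_in_output_size) (use eval \<open>timed\<close> in simp)
      moreover have "vsize (Num rhs) + 1 \<le> ?n" by (simp add: state_code_def)
      moreover have "1 \<le> ?n" by simp
      ultimately show "?n + 4 * ?n + (?n + 340 * ?n + (?n + (?n + (?n + 84 * ?n + 5460 * ?n + ?t) + 84 * ?n +
          (vsize (Pair (Num ?v) (Num rhs)) + 3)) + 84 * ?n))
          \<le> 10000 * ?n + 2 * ?t" unfolding vsize.simps(3) by linarith
    qed simp
    have "runs_in orc timed (step_prog S) ?x ?y
        (?n + 21844 * ?n + (?n + 21844 * ?n + (?n + 21844 * ?n + (10000 * ?n + 2 * ?t)))) (0 + (0 + (0 + 1)))"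
      unfolding step_prog_def
      by (rule runs_in_Cond_false[OF R0[OF test(1)] runs_in_Cond_false[OF L0[OF test(2)]
            runs_in_Cond_false[OF N0[OF test(3)] tp']]])
    then have "runs_in orc timed (step_prog S) ?x ?y (step_time ?n) 1"
    proof (rule runs_in_mono)
      have "vsize ?in \<le> ?n" by (simp add: state_code_def task_code_def T0)
      then have "?t \<le> C * ?n ^ k" by (intro mult_left_mono power_mono) auto
      then show "?n + 21844 * ?n + (?n + 21844 * ?n + (?n + 21844 * ?n + (10000 * ?n + 2 * ?t)))
          \<le> step_time ?n"
        unfolding step_time_def add_mult_distrib by linarith
    qed simp
    moreover have "vsize ?y \<le> growth * ?n"
    proof -
      have "vsize ?y \<le> ?n + 3"
        using vsize_bool_code[of ?ans] by (simp add: state_code_def del: bool_code_eq)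
      also have "\<dots> \<le> 4 * ?n" using vsize_pos(1)[of ?x] by linarith
      also have "\<dots> \<le> growth * ?n" by (simp add: growth_def)
      finally show ?thesis .
    qed
    moreover have "(\<Sum>T\<leftarrow>stack. task_weight (length js) T) <
        (\<Sum>T\<leftarrow>T0 # stack. task_weight (length js) T)"
      by (simp add: task_weight_def T0)
    moreover have "?ans \<and> (\<forall>T\<in>set stack. \<forall>Q\<in>set (task_leaves T). passes rhs Q) \<longleftrightarrow>
        ans \<and> (\<forall>T\<in>set (T0 # stack). \<forall>Q\<in>set (task_leaves T). passes rhs Q)"
      by (auto simp: task_leaves_def T0 test)
    moreover have "1 + (\<Sum>T\<leftarrow>stack. length (task_leaves T)) \<le>
        (\<Sum>T\<leftarrow>T0 # stack. length (task_leaves T))"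
      by (simp add: task_leaves_def T0 test)
    moreover have "\<forall>T\<in>set stack. good_task T" using good by simp
    ultimately show ?thesis by blast
  qed
qed

section \<open>Correctness and running time of the search\<close>

lemma step_time_mono: "n \<le> n' \<Longrightarrow> step_time n \<le> step_time n'"
  unfolding step_time_def by (intro add_mono mult_left_mono power_mono) auto

text \<open>
  Since a step multiplies the size by at most \<open>growth\<close> and decreases the weight, the product of the
  size of the state and \<open>growth\<close> to the power of its weight does not increase.  This gives the
  bound \<open>B\<close> on the size of all states.
\<close>

lemma loop_correct:
  assumes good: "\<And>T. T \<in> set stack \<Longrightarrow> good_task T"
    and N: "N = (\<Sum>T\<leftarrow>stack. task_weight (length js) T)"
    and B: "B = vsize (state_code d obj rhs (stack, True)) * growth ^ N"
  shows "\<exists>ans. (ans \<longleftrightarrow> (\<forall>T\<in>set stack. \<forall>Q\<in>set (task_leaves T). passes rhs Q)) \<and>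
    vsize (state_code d obj rhs ([], ans)) \<le> B \<and>
    runs_in orc timed (While (path [Right, Left, IsPair]) (step_prog S))
      (state_code d obj rhs (stack, True)) (state_code d obj rhs ([], ans))
      ((N + 1) * (341 * B + step_time B)) (\<Sum>T\<leftarrow>stack. length (task_leaves T))"
proof -
  let ?code = "state_code d obj rhs"
  let ?m = "\<lambda>(s :: task list, ans :: bool). \<Sum>T\<leftarrow>s. task_weight (length js) T"
  let ?q = "\<lambda>(s :: task list, ans :: bool). \<Sum>T\<leftarrow>s. length (task_leaves T)"
  let ?goal = "\<forall>T\<in>set stack. \<forall>Q\<in>set (task_leaves T). passes rhs Q"
  define I where "I = (\<lambda>(s, ans). (\<forall>T\<in>set s. good_task T) \<and>
    (ans \<and> (\<forall>T\<in>set s. \<forall>Q\<in>set (task_leaves T). passes rhs Q) \<longleftrightarrow> ?goal) \<and>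
    vsize (?code (s, ans)) * growth ^ ?m (s, ans) \<le> B)"
  have growth: "1 \<le> growth" by (simp add: growth_def)
  have size: "vsize (?code s) \<le> B" if "I s" for s
  proof -
    have "vsize (?code s) * 1 \<le> vsize (?code s) * growth ^ ?m s"
      using growth by (intro mult_left_mono) auto
    moreover have "vsize (?code s) * growth ^ ?m s \<le> B" using that by (cases s) (simp add: I_def)
    ultimately show ?thesis by linarith
  qed
  have "\<exists>s'. I s' \<and> \<not> fst s' \<noteq> [] \<and>
      runs_in orc timed (While (path [Right, Left, IsPair]) (step_prog S)) (?code (stack, True)) (?code s')
        ((?m (stack, True) + 1) * (341 * B + step_time B)) (?q (stack, True))"
  proof (rule runs_in_While[where I=I and code="?code" and s="(stack, True)" and G="\<lambda>s. fst s \<noteq> []"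
        and T="341 * B + step_time B" and U="\<lambda>s. 340 * vsize (?code s)"
        and V="\<lambda>s. step_time (vsize (?code s))" and m="?m" and Q="?q"])
    fix s assume s: "I s"
    show "runs_in orc timed (path [Right, Left, IsPair]) (?code s) (bool_code (fst s \<noteq> []))
        (340 * vsize (?code s)) 0"
      by (rule runs_in_arith_free; cases s; cases "fst s") (simp_all add: state_code_def)
    show "vsize (?code s) + 340 * vsize (?code s) + step_time (vsize (?code s)) \<le> 341 * B + step_time B"
      using size[OF s] step_time_mono[OF size[OF s]] by linarith
    show "\<exists>s' q. runs_in orc timed (step_prog S) (?code s) (?code s') (step_time (vsize (?code s))) q \<and>
      I s' \<and> ?m s' < ?m s \<and> q + ?q s' \<le> ?q s" if ne: "fst s \<noteq> []"
    proof -
      obtain T0 st ans where s_eq: "s = (T0 # st, ans)" using ne by (cases s; cases "fst s") auto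
      have g: "\<And>T. T \<in> set (T0 # st) \<Longrightarrow> good_task T" using s unfolding I_def s_eq by auto
      obtain stack' ans' q where step:
        "runs_in orc timed (step_prog S) (?code (T0 # st, ans)) (?code (stack', ans'))
          (step_time (vsize (?code (T0 # st, ans)))) q"
        "\<forall>T\<in>set stack'. good_task T"
        "ans' \<and> (\<forall>T\<in>set stack'. \<forall>Q\<in>set (task_leaves T). passes rhs Q) \<longleftrightarrow>
          ans \<and> (\<forall>T\<in>set (T0 # st). \<forall>Q\<in>set (task_leaves T). passes rhs Q)"
        "(\<Sum>T\<leftarrow>stack'. task_weight (length js) T) < (\<Sum>T\<leftarrow>T0 # st. task_weight (length js) T)"
        "q + (\<Sum>T\<leftarrow>stack'. length (task_leaves T)) \<le> (\<Sum>T\<leftarrow>T0 # st. length (task_leaves T))"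
        "vsize (?code (stack', ans')) \<le> growth * vsize (?code (T0 # st, ans))"
        using step_correct[OF g, where rhs=rhs and ans=ans] by blast
      have "vsize (?code (stack', ans')) * growth ^ ?m (stack', ans') \<le>
          (growth * vsize (?code s)) * growth ^ ?m (stack', ans')"
        using step(6) unfolding s_eq by (intro mult_right_mono) auto
      also have "\<dots> = vsize (?code s) * growth ^ (Suc (?m (stack', ans')))" by simp
      also have "\<dots> \<le> vsize (?code s) * growth ^ ?m s"
        using step(4) growth unfolding s_eq by (intro mult_left_mono power_increasing) auto
      also have "\<dots> \<le> B" using s by (cases s) (simp add: I_def)
      finally have "vsize (?code (stack', ans')) * growth ^ ?m (stack', ans') \<le> B" .
      then have "I (stack', ans')" using s step(2,3) unfolding I_def s_eq by simp
      then show ?thesis using step(1,4,5) unfolding s_eq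
        by (intro exI[of _ "(stack', ans')"] exI[of _ q]) simp
    qed
  next
    show "I (stack, True)" using good N B by (simp add: I_def)
  qed
  then obtain ans where *: "I ([], ans)"
    "runs_in orc timed (While (path [Right, Left, IsPair]) (step_prog S)) (?code (stack, True)) (?code ([], ans))
      ((N + 1) * (341 * B + step_time B)) (\<Sum>T\<leftarrow>stack. length (task_leaves T))"
    unfolding N by auto
  then show ?thesis using size[OF *(1)] unfolding I_def by auto
qed

end

text \<open>
  A bound on the time before the loop, dominated by the summation that yields \<open>(l - 1) \<alpha>\<close>.
\<close>

definition init_time :: "prog \<Rightarrow> nat \<Rightarrow> nat \<Rightarrow> nat \<Rightarrow> nat" where
  "init_time M C k n = (20 + cost_factor M + cost_factor (start_prog M)) * n +
     20000 * ((cost_factor M + 2) * n) ^ 2 * (5000 * ((cost_factor M + 2) * n) + C * ((cost_factor M + 2) * n) ^ k + 1)"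

definition search_time :: "prog \<Rightarrow> nat \<Rightarrow> nat \<Rightarrow> nat \<Rightarrow> nat \<Rightarrow> nat" where
  "search_time M C k N n = (let D = init_time M C k n; B = D * growth ^ N in
     341 * n + (D + ((N + 1) * (341 * B + ((200000 + growth) * B + 2 * (C * B ^ k))) + 84 * B)))"

context product_search
begin

lemma search_correct:
  fixes M :: prog and L :: "val list"
  defines "Y \<equiv> Pair d (Pair obj (set_code js))"
  assumes js: "js = j # js'" and l: "l \<ge> 1"
    and M: "loop_free M" "arith_free M" "loop_free_value M Y = list_code L" "length L = l - 1"
    and rational: "timed \<Longrightarrow> rational_data Y" and orc: "\<And>x y. timed \<Longrightarrow> orc x y \<Longrightarrow> rational_data y"
  shows "runs_in orc timed (search_prog S M) Y
    (bool_code (\<forall>Q\<in>set (completions js' [] [j] [] L). passes (w {} * (real l - 1)) Q))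
    (search_time M C k (3 ^ (length js' + Suc (length js) * (l - 1))) (vsize Y))
    ((l - 1) + l ^ length js')"
proof -
  let ?n = "vsize Y"
  let ?rhs = "w {} * (real l - 1)"
  let ?x = "Pair (list_code L) Y"
  define n' where "n' = (cost_factor M + 2) * ?n"
  define D where "D = init_time M C k ?n"
  define T where "T = 5000 * n' + C * n' ^ k"
  have Mrun: "runs_in orc timed M Y (list_code L) (cost_factor M * ?n) 0"
    by (rule runs_in_arith_free[OF M(1,2,3) refl])
  have n': "vsize ?x \<le> n'"
  proof -
    have "vsize (list_code L) \<le> cost_factor M * ?n" using arith_free_size[OF M(1,2), of Y] M(3) by simp
    moreover have "1 \<le> ?n" by simp
    ultimately have "1 + vsize (list_code L) + ?n \<le> cost_factor M * ?n + 2 * ?n" by linarith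
    then show ?thesis by (simp add: n'_def add_mult_distrib)
  qed
  have alpha: "runs_in orc timed (alpha_prog S)
      (Pair (id z) Y) (Num (w {})) T 1" if z: "z \<in> set L" for z
  proof -
    let ?y = "Pair z Y"
    let ?in = "Pair d (parts_code obj [[]])"
    have "runs_in orc timed (Fork (path [Right, Left]) (Fork (Fork (path [Right, Right, Left]) empty_prog) empty_prog))
        ?y ?in (435 * vsize ?y) 0"
      by (rule runs_in_arith_free) (simp_all add: Y_def)
    moreover have "runs_in orc timed S ?in (Num (\<Sum>B\<leftarrow>[[]]. w (set B))) (C * vsize ?in ^ k) 1"
      by (rule evaluates) (use l in auto)
    ultimately have "runs_in orc timed (alpha_prog S) ?y (Num (w {})) (435 * vsize ?y + C * vsize ?in ^ k) (0 + 1)"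
      unfolding alpha_prog_def using runs_in_Then by fastforce
    then show ?thesis unfolding id_apply
    proof (rule runs_in_mono)
      have "vsize z \<le> vsize (list_code L)" using z by (induction L) auto
      then have y: "vsize ?y \<le> n'" using n' by simp
      have "vsize ?in \<le> vsize ?y" using vsize_pos(1)[of z] by (simp add: Y_def js)
      then have "vsize ?in \<le> n'" using y by linarith
      then have "C * vsize ?in ^ k \<le> C * n' ^ k" by (intro mult_left_mono power_mono) auto
      then show "435 * vsize ?y + C * vsize ?in ^ k \<le> T" using y unfolding T_def by linarith
    qed simp
  qed
  have "runs_in orc timed (sum_prog (alpha_prog S))
      (Pair (list_code (map id L)) Y) (Num (\<Sum>z\<leftarrow>L. w {}))
      (20000 * vsize (Pair (list_code (map id L)) Y) ^ 2 * (T + 1)) (length L * 1)"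
  proof (rule runs_in_sum_prog)
    fix z assume "z \<in> set L"
    then show "runs_in orc timed (alpha_prog S)
      (Pair (id z) Y) (Num (w {})) T 1" by (rule alpha)
  next
    assume timed
    have "rational_data (list_code L)"
      by (rule runs_in_rational[OF Mrun]) (use orc rational \<open>timed\<close> in blast)+
    then show "rational_data (Pair (list_code (map id L)) Y)" using rational \<open>timed\<close> by simp
  qed (rule orc)
  moreover have "(\<Sum>z\<leftarrow>L. w {}) = ?rhs" using M(4) l by (simp add: sum_list_triv of_nat_diff)
  moreover have "runs_in orc timed (Fork M (Op Ident)) Y ?x (?n + cost_factor M * ?n + 4 * ?n) (0 + 0)"
    by (rule runs_in_Fork[OF Mrun runs_in_arith_free]) simp_all
  ultimately have rhs: "runs_in orc timed (rhs_prog S M) Y (Num ?rhs)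
      (?n + cost_factor M * ?n + 4 * ?n + 20000 * vsize ?x ^ 2 * (T + 1)) (0 + 0 + length L * 1)"
    unfolding rhs_prog_def using runs_in_Then by fastforce
  let ?T0 = "(js', [], [j], [], L)"
  let ?s0 = "state_code d obj ?rhs ([?T0], True)"
  have start: "runs_in orc timed (start_prog M) Y (list_code (map (task_code obj) [?T0])) (cost_factor (start_prog M) * ?n) 0"
    by (rule runs_in_arith_free) (use M in \<open>simp_all add: start_prog_def task_code_def Y_def js\<close>)
  have left: "runs_in orc timed (Op Left) Y d (4 * ?n) 0"
    and one: "runs_in orc timed (Op MkOne) Y (bool_code True) (4 * ?n) 0"
    by (rule runs_in_arith_free; simp add: Y_def)+
  have init_parts: "runs_in orc timed (Fork (Fork (Op Left) (rhs_prog S M)) (Fork (start_prog M) (Op MkOne))) Y ?s0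
      (?n + (?n + 4 * ?n + (?n + cost_factor M * ?n + 4 * ?n + 20000 * vsize ?x ^ 2 * (T + 1))) + (?n + cost_factor (start_prog M) * ?n + 4 * ?n))
      (0 + (0 + 0 + length L * 1) + (0 + 0))"
    unfolding state_code_def prod.case
    by (rule runs_in_Fork[OF runs_in_Fork[OF left rhs] runs_in_Fork[OF start one]])
  have D_eq: "D = (20 * ?n + cost_factor M * ?n + cost_factor (start_prog M) * ?n) + 20000 * n' ^ 2 * (T + 1)"
    by (simp only: D_def init_time_def n'_def T_def add_mult_distrib)
  have init: "runs_in orc timed (Fork (Fork (Op Left) (rhs_prog S M)) (Fork (start_prog M) (Op MkOne))) Y ?s0
      D (length L)"
  proof (rule runs_in_mono[OF init_parts])
    have "20000 * vsize ?x ^ 2 * (T + 1) \<le> 20000 * n' ^ 2 * (T + 1)"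
      using n' by (intro mult_right_mono mult_left_mono power_mono) auto
    then show "?n + (?n + 4 * ?n + (?n + cost_factor M * ?n + 4 * ?n + 20000 * vsize ?x ^ 2 * (T + 1))) + (?n + cost_factor (start_prog M) * ?n + 4 * ?n) \<le> D"
      unfolding D_eq by linarith
  qed simp
  define N where "N = (\<Sum>T\<leftarrow>[?T0]. task_weight (length js) T)"
  define B where "B = vsize ?s0 * growth ^ N"
  have good: "good_task T" if "T \<in> set [?T0]" for T
    using that M(4) l unfolding good_task_def by (simp add: js)
  obtain ans where ans: "ans \<longleftrightarrow> (\<forall>T\<in>set [?T0]. \<forall>Q\<in>set (task_leaves T). passes ?rhs Q)"
    "vsize (state_code d obj ?rhs ([], ans)) \<le> B"
    "runs_in orc timed (While (path [Right, Left, IsPair]) (step_prog S)) ?s0 (state_code d obj ?rhs ([], ans))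
      ((N + 1) * (341 * B + step_time B)) (\<Sum>T\<leftarrow>[?T0]. length (task_leaves T))"
    using loop_correct[OF good N_def B_def] by blast
  have final: "runs_in orc timed (path [Right, Right]) (state_code d obj ?rhs ([], ans)) (bool_code ans)
      (84 * vsize (state_code d obj ?rhs ([], ans))) 0"
    by (rule runs_in_arith_free) (simp_all add: state_code_def)
  have cond: "runs_in orc timed (path [Right, Right, IsPair]) Y (Num 1) (340 * ?n) 0"
    by (rule runs_in_arith_free) (simp_all add: Y_def js)
  have "runs_in orc timed (search_prog S M) Y (bool_code ans)
      (?n + 340 * ?n + (D + ((N + 1) * (341 * B + step_time B) + 84 * vsize (state_code d obj ?rhs ([], ans)))))
      (0 + (length L + ((\<Sum>T\<leftarrow>[?T0]. length (task_leaves T)) + 0)))"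
    unfolding search_prog_def
    by (rule runs_in_Cond_true[OF cond _ runs_in_Then[OF init runs_in_Then[OF ans(3) final]]]) simp
  moreover have "ans \<longleftrightarrow> (\<forall>Q\<in>set (completions js' [] [j] [] L). passes ?rhs Q)"
    using ans(1) by (simp add: task_leaves_def)
  moreover have N: "N = 3 ^ (length js' + Suc (length js) * (l - 1))"
    using M(4) by (simp add: N_def task_weight_def)
  moreover have "length L + (\<Sum>T\<leftarrow>[?T0]. length (task_leaves T)) = (l - 1) + l ^ length js'"
    using M(4) l by (simp add: task_leaves_def length_completions)
  moreover have "?n + 340 * ?n + (D + ((N + 1) * (341 * B + step_time B) + 84 * vsize (state_code d obj ?rhs ([], ans))))
      \<le> search_time M C k N ?n" if timed
  proof -
    have "vsize ?s0 \<le> D" by (rule runs_in_output_size) (use init that in simp)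
    then have B: "B \<le> D * growth ^ N" unfolding B_def by (rule mult_right_mono) simp
    have "(N + 1) * (341 * B + step_time B) \<le> (N + 1) * (341 * (D * growth ^ N) + step_time (D * growth ^ N))"
      using B step_time_mono[OF B] by (intro mult_left_mono add_mono) auto
    moreover have "84 * vsize (state_code d obj ?rhs ([], ans)) \<le> 84 * (D * growth ^ N)"
      using B ans(2) by linarith
    ultimately show ?thesis
      unfolding search_time_def Let_def D_def[symmetric] step_time_def[symmetric] by linarith
  qed
  ultimately show ?thesis by (auto elim!: runs_in_mono)
qed

end

text \<open>
  The constants \<open>A\<close> and \<open>m\<close> depend on the programs only.  A polynomial of degree \<open>k + 1\<close> is evaluated at a
  size \<open>D * growth ^ N\<close>, where \<open>D\<close> is polynomial in \<open>n\<close>; everything that depends on \<open>N\<close> is absorbed by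
  the base of \<open>A ^ N\<close>.
\<close>

lemma search_time_bound:
  "\<exists>A m. 1 \<le> A \<and> (\<forall>N n. 1 \<le> N \<longrightarrow> 1 \<le> n \<longrightarrow> search_time M C k N n \<le> A ^ N * n ^ m)"
proof -
  define g where "g = cost_factor M + 2"
  define c where "c = 20 + cost_factor M + cost_factor (start_prog M) + 20000 * g ^ 2 * (5000 * g + C * g ^ k + 1)"
  define e where "e = 300000 + growth + 2 * C"
  define A where "A = 3 * e * c ^ (k + 1) * growth ^ (k + 1)"
  have c1: "1 \<le> c" "1 \<le> growth" "1 \<le> e" by (simp_all add: c_def growth_def e_def)
  have A1: "1 \<le> A" using c1 by (simp add: A_def Suc_le_eq)
  have init: "n \<le> init_time M C k n \<and> init_time M C k n \<le> c * n ^ (k + 3)" if n: "1 \<le> n" for n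
  proof
    show "n \<le> init_time M C k n" by (simp add: init_time_def add_mult_distrib)
    have p: "n ^ i \<le> n ^ (k + 3)" if "i \<le> k + 3" for i using n that by (intro power_increasing) auto
    have collect: "20000 * (g * n) ^ 2 * (x * n ^ (k + 1)) = 20000 * g ^ 2 * x * n ^ (k + 3)" for x
      by (simp add: power_mult_distrib power_add power2_eq_square power3_eq_cube mult_ac)
    have "5000 * (g * n) + C * (g * n) ^ k + 1 \<le> (5000 * g + C * g ^ k + 1) * n ^ (k + 1)"
    proof -
      have "5000 * g * n ^ 1 \<le> 5000 * g * n ^ (k + 1)" "C * g ^ k * n ^ k \<le> C * g ^ k * n ^ (k + 1)"
        using n by (intro mult_left_mono power_increasing; simp)+
      moreover have "1 \<le> n ^ (k + 1)" using n by (intro one_le_power)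
      moreover have "(5000 * g + C * g ^ k + 1) * n ^ (k + 1) =
          5000 * g * n ^ (k + 1) + C * g ^ k * n ^ (k + 1) + n ^ (k + 1)"
        by (simp add: add_mult_distrib)
      moreover have "5000 * (g * n) + C * (g * n) ^ k + 1 = 5000 * g * n ^ 1 + C * g ^ k * n ^ k + 1"
        by (simp add: power_mult_distrib)
      ultimately show ?thesis by linarith
    qed
    then have "20000 * (g * n) ^ 2 * (5000 * (g * n) + C * (g * n) ^ k + 1) \<le>
        20000 * (g * n) ^ 2 * ((5000 * g + C * g ^ k + 1) * n ^ (k + 1))"
      by (rule mult_left_mono) simp
    also have "\<dots> = 20000 * g ^ 2 * (5000 * g + C * g ^ k + 1) * n ^ (k + 3)"
      by (rule collect)
    finally have "init_time M C k n \<le> (20 + cost_factor M + cost_factor (start_prog M)) * n ^ (k + 3) +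
        20000 * g ^ 2 * (5000 * g + C * g ^ k + 1) * n ^ (k + 3)"
      unfolding init_time_def g_def[symmetric] using p[of 1] by (intro add_mono mult_left_mono) auto
    then show "init_time M C k n \<le> c * n ^ (k + 3)" by (simp add: c_def add_mult_distrib)
  qed
  have "search_time M C k N n \<le> A ^ N * n ^ ((k + 3) * (k + 1))" if N: "1 \<le> N" and n: "1 \<le> n" for N n
  proof -
    define D where "D = init_time M C k n"
    define B where "B = D * growth ^ N"
    define X where "X = B ^ (k + 1)"
    have D: "n \<le> D" "D \<le> c * n ^ (k + 3)" using init[OF n] by (simp_all add: D_def)
    have "D * 1 \<le> D * growth ^ N" using c1 by (intro mult_left_mono one_le_power) auto
    then have DB: "D \<le> B" by (simp add: B_def)
    have B1: "1 \<le> B" using n D(1) DB by linarith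
    have BX: "B \<le> X" using power_increasing[of 1 "k + 1" B] B1 by (simp add: X_def)
    have BkX: "B ^ k \<le> X" using power_increasing[of k "k + 1" B] B1 by (simp add: X_def)
    have "341 * B + ((200000 + growth) * B + 2 * (C * B ^ k)) \<le> (200341 + growth + 2 * C) * X"
    proof -
      have "(200341 + growth) * B \<le> (200341 + growth) * X" "2 * C * B ^ k \<le> 2 * C * X"
        using BX BkX by (intro mult_left_mono; simp)+
      then show ?thesis unfolding add_mult_distrib by linarith
    qed
    then have "(N + 1) * (341 * B + ((200000 + growth) * B + 2 * (C * B ^ k))) \<le>
        (N + 1) * ((200341 + growth + 2 * C) * X)" by (rule mult_left_mono) simp
    moreover have "search_time M C k N n = 341 * n + (D +
        ((N + 1) * (341 * B + ((200000 + growth) * B + 2 * (C * B ^ k))) + 84 * B))"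
      by (simp only: search_time_def Let_def D_def B_def)
    ultimately have "search_time M C k N n \<le> 426 * X + (N + 1) * ((200341 + growth + 2 * C) * X)"
      using D(1) DB BX by linarith
    also have "\<dots> \<le> (N + 2) * (e * X)" by (simp add: e_def algebra_simps)
    also have "\<dots> \<le> 3 ^ N * (e ^ N * ((c ^ (k + 1)) ^ N * (growth ^ (k + 1)) ^ N * n ^ ((k + 3) * (k + 1))))"
    proof (intro mult_mono)
      show "N + 2 \<le> 3 ^ N" using N by (induction N rule: dec_induct) auto
      show "e \<le> e ^ N" using power_increasing[of 1 N e] N c1 by simp
      have "X \<le> (c * n ^ (k + 3) * growth ^ N) ^ (k + 1)"
        unfolding X_def B_def using D(2) by (intro power_mono mult_right_mono) auto
      also have "\<dots> = c ^ (k + 1) * (growth ^ (k + 1)) ^ N * n ^ ((k + 3) * (k + 1))"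
        by (simp only: power_mult_distrib power_mult[symmetric] mult_ac)
      also have "\<dots> \<le> (c ^ (k + 1)) ^ N * (growth ^ (k + 1)) ^ N * n ^ ((k + 3) * (k + 1))"
        using power_increasing[of 1 N "c ^ (k + 1)"] N c1 by (intro mult_right_mono) auto
      finally show "X \<le> (c ^ (k + 1)) ^ N * (growth ^ (k + 1)) ^ N * n ^ ((k + 3) * (k + 1))" .
    qed auto
    also have "\<dots> = A ^ N * n ^ ((k + 3) * (k + 1))"
      by (simp only: A_def power_mult_distrib mult_ac)
    finally show ?thesis .
  qed
  then show ?thesis using A1 by blast
qed

section \<open>A computable bound\<close>

lemma runs_in_loop_free:
  assumes "loop_free p" and "loop_free_value p x = y"
  shows "runs_in orc False p x y 0 0"
  using exec_loop_free[OF assms(1)] assms(2) unfolding runs_in_def by blast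

primrec const_prog :: "nat \<Rightarrow> prog" where
  "const_prog 0 = zero_prog"
| "const_prog (Suc n) = Fork (const_prog n) (Op MkOne) ;; Op Plus"

lemma const_prog: "loop_free (const_prog n)" "loop_free_value (const_prog n) x = Num (real n)"
  by (induction n) (simp_all add: zero_prog_def add.commute)

definition pow_test :: prog where
  "pow_test = Fork (Op MkOne) (Op Left) ;; Op Leq"

definition pow_step :: prog where
  "pow_step = Fork (Fork (Op Left) (Op MkOne) ;; Op Minus) (Fork (path [Right, Left]) (Op Right ;; Op Times))"

definition pow_prog :: prog where
  "pow_prog = Fork (Op Right) (Fork (Op Left) (Op MkOne)) ;;
     While pow_test pow_step ;;
     path [Right, Right]"

lemma runs_in_pow_prog:
  "runs_in orc False pow_prog (Pair (Num a) (Num (real n))) (Num (a ^ n)) 0 0"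
proof -
  define code where "code = (\<lambda>i. Pair (Num (real i)) (Pair (Num a) (Num (a ^ (n - i)))))"
  have "\<exists>i. i \<le> n \<and> \<not> 1 \<le> i \<and> runs_in orc False (While pow_test pow_step)
      (code n) (code i) ((n + 1) * 0) 0"
  proof (rule runs_in_While[where I="\<lambda>i. i \<le> n" and s=n and code=code and G="\<lambda>i. 1 \<le> i"
        and U="\<lambda>_. 0" and V="\<lambda>_. 0" and T=0 and m="\<lambda>i. i" and Q="\<lambda>_. 0"])
    fix i assume i: "i \<le> n"
    show "runs_in orc False pow_test (code i) (bool_code (1 \<le> i)) 0 0"
      by (rule runs_in_loop_free) (simp_all add: code_def pow_test_def del: bool_code_eq)
    assume "1 \<le> i"
    then obtain i' where i': "i = Suc i'" by (cases i) auto
    have "runs_in orc False pow_step (code i) (code i') 0 0"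
      by (rule runs_in_loop_free) (use i i' in \<open>simp_all add: code_def pow_step_def Suc_diff_Suc flip: power_Suc\<close>)
    then show "\<exists>s' q. runs_in orc False pow_step (code i) (code s') 0 q \<and> s' \<le> n \<and> s' < i \<and> q + 0 \<le> 0"
      using i i' by (intro exI[of _ i'] exI[of _ 0]) auto
  qed auto
  then obtain i where "\<not> 1 \<le> i" and run: "runs_in orc False (While pow_test pow_step)
      (code n) (code i) ((n + 1) * 0) 0" by blast
  then have "i = 0" by simp
  with run have loop: "runs_in orc False (While pow_test pow_step)
      (code n) (code 0) 0 0" by (simp only: mult_0_right)
  have init: "runs_in orc False (Fork (Op Right) (Fork (Op Left) (Op MkOne))) (Pair (Num a) (Num (real n))) (code n) 0 0"
    and final: "runs_in orc False (path [Right, Right]) (code 0) (Num (a ^ n)) 0 0"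
    by (rule runs_in_loop_free; simp add: code_def)+
  show ?thesis unfolding pow_prog_def using runs_in_Then[OF init runs_in_Then[OF loop final]] by simp
qed

lemma computable_double_power: "computable (\<lambda>n. A ^ (B ^ ((n + 1) ^ 2)))"
proof -
  let ?inc = "Fork (Op Ident) (Op MkOne) ;; Op Plus"
  let ?sq = "Fork ?inc ?inc ;; Op Times"
  let ?p = "Fork (const_prog A) (Fork (const_prog B) ?sq ;; pow_prog) ;; pow_prog"
  have "\<exists>t. runs ?p (Num (real n)) (Num (real (A ^ (B ^ ((n + 1) ^ 2))))) t" for n
  proof -
    let ?orc = "\<lambda>_ _. False"
    have 1: "runs_in ?orc False (Fork (const_prog B) ?sq) (Num (real n)) (Pair (Num (real B)) (Num (real ((n + 1) ^ 2)))) 0 0"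
      by (rule runs_in_loop_free) (simp_all add: const_prog power2_eq_square algebra_simps)
    have 2: "runs_in ?orc False (const_prog A) (Num (real n)) (Num (real A)) 0 0"
      by (rule runs_in_loop_free) (simp_all add: const_prog)
    have pow: "runs_in ?orc False pow_prog (Pair (Num (real a)) (Num (real m))) (Num (real (a ^ m))) 0 0" for a m
      using runs_in_pow_prog[of ?orc "real a" m] by simp
    have "runs_in ?orc False ?p (Num (real n)) (Num (real (A ^ (B ^ ((n + 1) ^ 2)))))
        (vsize (Num (real n)) + 0 + (0 + 0) + 0) (0 + (0 + 0) + 0)"
      by (rule runs_in_Then[OF runs_in_Fork[OF 2 runs_in_Then[OF 1 pow]] pow])
    then show ?thesis unfolding runs_in_def runs_def by auto
  qed
  then show ?thesis unfolding computable_def by blast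
qed

section \<open>Deciding membership\<close>

text \<open>
  A product is optimized by optimizing each factor.
\<close>

lemma is_max_product:
  assumes "cone_instance E K" and "\<And>A. A \<in> set Q \<Longrightarrow> set A \<subseteq> E"
  shows "is_max (product_feasible (truncation E K) (map (\<lambda>A. (c, A)) Q))
    (product_objective E (map (\<lambda>A. (c, A)) Q)) (\<Sum>A\<leftarrow>Q. opt_value E K c (set A))"
proof -
  let ?P = "truncation E K"
  have max: "is_max (zero_on ?P (set (Q ! i))) (dot E c) (opt_value E K c (set (Q ! i)))" if "i < length Q" for i
    by (rule is_max_opt_value[OF assms(1)]) (use assms(2) that in auto)
  have "\<exists>z. z \<in> zero_on ?P (set (Q ! i)) \<and> dot E c z = opt_value E K c (set (Q ! i))" if "i < length Q" for i
    using max[OF that] unfolding is_max_def by blast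
  then obtain z where z: "\<And>i. i < length Q \<Longrightarrow> z i \<in> zero_on ?P (set (Q ! i)) \<and> dot E c (z i) = opt_value E K c (set (Q ! i))"
    by metis
  show ?thesis unfolding is_max_def
  proof
    show "\<exists>zs\<in>product_feasible ?P (map (\<lambda>A. (c, A)) Q).
      product_objective E (map (\<lambda>A. (c, A)) Q) zs = (\<Sum>A\<leftarrow>Q. opt_value E K c (set A))"
      by (rule bexI[of _ "map z [0..<length Q]"])
        (use z in \<open>auto simp: product_feasible_def product_objective_def sum_list_sum_nth atLeast0LessThan\<close>)
    show "\<forall>zs\<in>product_feasible ?P (map (\<lambda>A. (c, A)) Q).
      product_objective E (map (\<lambda>A. (c, A)) Q) zs \<le> (\<Sum>A\<leftarrow>Q. opt_value E K c (set A))"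
    proof
      fix zs assume "zs \<in> product_feasible ?P (map (\<lambda>A. (c, A)) Q)"
      then have "dot E c (zs ! i) \<le> opt_value E K c (set (Q ! i))" if "i < length Q" for i
        using max[OF that] that unfolding product_feasible_def is_max_def by auto
      then show "product_objective E (map (\<lambda>A. (c, A)) Q) zs \<le> (\<Sum>A\<leftarrow>Q. opt_value E K c (set A))"
        unfolding product_objective_def by (auto simp: sum_list_sum_nth atLeast0LessThan intro!: sum_mono)
    qed
  qed
qed

lemma product_search_oracle:
  assumes "cone_instance E K" and "enumerates es E" and "distinct js" and "set js \<subseteq> E"
  shows "product_search (lp_oracle E (truncation E K) l) False (Op Right ;; Query) Empty (vec_code es c)
    (opt_value E K c) js l 0 0"
proof
  fix Q :: "nat list list"
  assume Q: "length Q \<le> l" "distinct (concat Q)" "set (concat Q) \<subseteq> set js"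
  let ?lp = "map (\<lambda>A. (c, A)) Q"
  have sub: "set A \<subseteq> E" if "A \<in> set Q" for A using Q(3) assms(4) that by auto
  have "distinct A" if "A \<in> set Q" for A using Q(2) that by (simp add: distinct_concat_iff)
  then have "lp_oracle E (truncation E K) l (parts_code (vec_code es c) Q) (Num (\<Sum>B\<leftarrow>Q. opt_value E K c (set B)))"
    unfolding lp_oracle_def using assms(2) Q(1) sub is_max_product[OF assms(1) sub, of Q c]
    by (intro exI[of _ es] exI[of _ ?lp] exI[of _ "\<Sum>B\<leftarrow>Q. opt_value E K c (set B)"])
      (auto simp: lp_code_def parts_code_def comp_def)
  then have "runs_in (lp_oracle E (truncation E K) l) False Query (parts_code (vec_code es c) Q)
      (Num (\<Sum>B\<leftarrow>Q. opt_value E K c (set B))) 0 1"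
    unfolding runs_in_def using exec.Query by blast
  moreover have "runs_in (lp_oracle E (truncation E K) l) False (Op Right)
      (Pair Empty (parts_code (vec_code es c) Q)) (parts_code (vec_code es c) Q) 0 0"
    by (rule runs_in_loop_free) simp_all
  ultimately have "runs_in (lp_oracle E (truncation E K) l) False (Op Right ;; Query)
      (Pair Empty (parts_code (vec_code es c) Q)) (Num (\<Sum>B\<leftarrow>Q. opt_value E K c (set B))) (0 + 0) (0 + 1)"
    by (intro runs_in_Then)
  then show "runs_in (lp_oracle E (truncation E K) l) False (Op Right ;; Query)
      (Pair Empty (parts_code (vec_code es c) Q)) (Num (\<Sum>B\<leftarrow>Q. opt_value E K c (set B)))
      (0 * vsize (Pair Empty (parts_code (vec_code es c) Q)) ^ 0) 1" by simp
qed fact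

abbreviation swap_prog :: prog where "swap_prog \<equiv> Fork (Op Right) (Op Left)"

text \<open>
  Polynomial-time optimization over single factors suffices: the value of a product is the sum of the
  values of its factors, which \<open>sum_prog\<close> computes.
\<close>

lemma product_search_solver:
  assumes solver: "\<And>A. distinct A \<Longrightarrow> set A \<subseteq> set js \<Longrightarrow>
      \<exists>t. runs p (Pair d (Pair obj (set_code A))) (Num (w (set A))) t \<and>
        t \<le> C * vsize (Pair d (Pair obj (set_code A))) ^ k"
    and rational: "rational_data (Pair d obj)" and "distinct js"
  shows "product_search (\<lambda>_ _. False) True (swap_prog ;; sum_prog (swap_prog ;; p)) d obj w js l
    (300000 + 20000 * C) (k + 3)"
proof
  fix Q :: "nat list list"
  assume Q: "distinct (concat Q)" "set (concat Q) \<subseteq> set js"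
  let ?in = "Pair d (parts_code obj Q)"
  let ?part = "\<lambda>A. Pair obj (set_code A)"
  let ?orc = "\<lambda>_ _. False"
  define n where "n = vsize ?in"
  have n1: "1 \<le> n" by (simp add: n_def)
  have swap: "runs_in ?orc True swap_prog (Pair x y) (Pair y x) (9 * vsize (Pair x y)) 0" for x y
    by (rule runs_in_arith_free) simp_all
  have part: "runs_in ?orc True (swap_prog ;; p) (Pair (?part A) d) (Num (w (set A))) (9 * n + C * n ^ k) 0"
    if A: "A \<in> set Q" for A
  proof -
    have "distinct A" "set A \<subseteq> set js" using Q A by (auto simp: distinct_concat_iff)
    then obtain t where t: "runs p (Pair d (?part A)) (Num (w (set A))) t" "t \<le> C * vsize (Pair d (?part A)) ^ k"
      using solver by blast
    have "vsize (?part A) \<le> vsize (parts_code obj Q)" using A by (induction Q) auto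
    then have size: "vsize (Pair d (?part A)) \<le> n" "vsize (Pair (?part A) d) \<le> n" by (simp_all add: n_def)
    then have "t \<le> C * n ^ k" using t(2) by (meson le_trans mult_left_mono power_mono zero_le)
    then have "runs_in ?orc True p (Pair d (?part A)) (Num (w (set A))) (C * n ^ k) 0"
      using t(1) unfolding runs_def runs_in_def by blast
    then have "runs_in ?orc True (swap_prog ;; p) (Pair (?part A) d) (Num (w (set A)))
        (9 * vsize (Pair (?part A) d) + C * n ^ k) (0 + 0)"
      by (rule runs_in_Then[OF swap])
    then show ?thesis by (rule runs_in_mono) (use size(2) in simp_all)
  qed
  have code: "list_code (map ?part Q) = parts_code obj Q" by (simp add: parts_code_def)
  have "runs_in ?orc True (sum_prog (swap_prog ;; p)) (Pair (list_code (map ?part Q)) d) (Num (\<Sum>A\<leftarrow>Q. w (set A)))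
      (20000 * vsize (Pair (list_code (map ?part Q)) d) ^ 2 * (9 * n + C * n ^ k + 1)) (length Q * 0)"
  proof (rule runs_in_sum_prog)
    show "rational_data (Pair (list_code (map ?part Q)) d)"
      using rational by (auto simp: rational_list_code set_code_def)
  qed (use part in simp_all)
  from runs_in_Then[OF swap this[unfolded code]]
  show "runs_in ?orc True (swap_prog ;; sum_prog (swap_prog ;; p)) ?in (Num (\<Sum>A\<leftarrow>Q. w (set A)))
      ((300000 + 20000 * C) * vsize ?in ^ (k + 3)) 1"
  proof (rule runs_in_mono)
    have sz: "vsize (Pair (parts_code obj Q) d) = n" by (simp add: n_def)
    have p: "n ^ i \<le> n ^ (k + 3)" if "i \<le> k + 3" for i using that n1 by (rule power_increasing)
    have "n \<le> n ^ (k + 3)" "n ^ 3 \<le> n ^ (k + 3)" "n ^ 2 \<le> n ^ (k + 3)"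
      using p[of 1] p[of 2] p[of 3] by simp_all
    moreover have "C * n ^ (k + 2) \<le> C * n ^ (k + 3)" using n1 by (intro mult_left_mono power_increasing) auto
    moreover have "20000 * n ^ 2 * (9 * n + C * n ^ k + 1) = 180000 * n ^ 3 + 20000 * (C * n ^ (k + 2)) + 20000 * n ^ 2"
      by (simp add: power_add power2_eq_square power3_eq_cube algebra_simps)
    ultimately have "9 * n + 20000 * n ^ 2 * (9 * n + C * n ^ k + 1) \<le> 300000 * n ^ (k + 3) + 20000 * (C * n ^ (k + 3))"
      by linarith
    then show "9 * vsize ?in + 20000 * vsize (Pair (parts_code obj Q) d) ^ 2 * (9 * n + C * n ^ k + 1)
      \<le> (300000 + 20000 * C) * vsize ?in ^ (k + 3)"
      unfolding sz n_def[symmetric] by (simp add: add_mult_distrib)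
  qed simp
qed fact

lemma runs_in_search_prog_empty:
  "runs_in orc timed (search_prog S M) (Pair d (Pair obj (set_code []))) Empty
    (400 * vsize (Pair d (Pair obj (set_code [])))) 0"
proof -
  let ?Y = "Pair d (Pair obj (set_code []))"
  have 1: "runs_in orc timed (path [Right, Right, IsPair]) ?Y Empty (340 * vsize ?Y) 0"
    and 2: "runs_in orc timed empty_prog ?Y Empty (4 * vsize ?Y) 0"
    by (rule runs_in_arith_free; simp)+
  show ?thesis unfolding search_prog_def
    by (rule runs_in_mono[OF runs_in_Cond_false[OF 1 2]]) simp_all
qed

text \<open>
  The search spends \<open>l - 1\<close> queries on \<open>(l - 1) \<alpha>\<close> and one on each of the partitions, whose number is
  \<open>l ^ (|J| - 1)\<close>.
\<close>

lemma search_prog_decides_B_fam: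
  assumes cone: "cone_instance E K" and max: "is_max (truncation E K) (dot E c) \<alpha>"
    and js: "distinct (j # js)" "set (j # js) \<subseteq> E" and l: "l \<ge> 1"
    and search: "product_search orc timed S d obj (opt_value E K c) (j # js) l C k"
    and M: "loop_free M" "arith_free M" "loop_free_value M (Pair d (Pair obj (set_code (j # js)))) = list_code L"
      "length L = l - 1"
    and rational: "timed \<Longrightarrow> rational_data (Pair d obj)" and orc: "\<And>x y. timed \<Longrightarrow> orc x y \<Longrightarrow> rational_data y"
  shows "runs_in orc timed (search_prog S M) (Pair d (Pair obj (set_code (j # js))))
    (bool_code (set (j # js) \<in> B_fam l E (truncation E K) c \<alpha>))
    (search_time M C k (3 ^ (length js + Suc (length (j # js)) * (l - 1))) (vsize (Pair d (Pair obj (set_code (j # js))))))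
    (l ^ length (j # js))"
proof -
  interpret product_search orc timed S d obj "opt_value E K c" "j # js" l C k by (rule search)
  have "rational_data (set_code xs)" for xs by (auto simp: set_code_def rational_list_code)
  then have rat: "timed \<Longrightarrow> rational_data (Pair d (Pair obj (set_code (j # js))))"
    using rational by simp
  have member: "(set (j # js) \<in> B_fam l E (truncation E K) c \<alpha>) =
      (\<forall>Q\<in>set (completions js [] [j] [] L). passes (opt_value E K c {} * (real l - 1)) Q)"
    using B_fam_iff_completions[OF cone max js M(4) l] opt_value_empty[OF max] by simp
  have queries: "(l - 1) + l ^ length js \<le> l ^ length (j # js)"
  proof -
    obtain i where i: "l = Suc i" using l by (cases l) auto
    have "i * 1 \<le> i * l ^ length js" using l by (intro mult_left_mono one_le_power) auto
    then show ?thesis by (simp add: i)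
  qed
  show ?thesis unfolding member
    by (rule runs_in_mono[OF search_correct[OF refl l M rat orc] le_refl queries])
qed

text \<open>
  The number \<open>l\<close> of factors is a function \<open>len\<close> of \<open>|J|\<close>: a constant for \<open>B\<^sub>l\<close> and the identity for \<open>B\<^sub>\<infinity>\<close>.
  With an oracle no description of the cone is needed, and \<open>Empty\<close> takes its place.
\<close>

lemma decides_with_lps_search_prog:
  fixes len :: "nat \<Rightarrow> nat"
  assumes M: "loop_free M" "arith_free M"
      "\<And>d obj j js. \<exists>L. loop_free_value M (Pair d (Pair obj (set_code (j # js)))) = list_code L \<and>
         length L = len (Suc (length js)) - 1"
    and len: "\<And>n. 1 \<le> n \<Longrightarrow> 1 \<le> len n"
    and F: "J \<noteq> {} \<Longrightarrow> b \<longleftrightarrow> J \<in> B_fam (len (card J)) E (truncation E K) c \<alpha>" "J = {} \<Longrightarrow> \<not> b"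
    and inst: "cone_instance E K" "is_max (truncation E K) (dot E c) \<alpha>" "J \<subseteq> E"
  shows "decides_with_lps (Fork empty_prog (Op Ident) ;; search_prog (Op Right ;; Query) M)
    E K c J b (len (card J)) (len (card J) ^ card J)"
  unfolding decides_with_lps_def
proof (intro allI impI)
  fix es js assume es: "enumerates es E" and js: "enumerates js J"
  let ?l = "len (card J)"
  let ?orc = "lp_oracle E (truncation E K) ?l"
  let ?x = "Pair (vec_code es c) (set_code js)"
  have card: "card J = length js" "set js = J" "distinct js" using js distinct_card unfolding enumerates_def by auto
  have "\<exists>T. runs_in ?orc False (search_prog (Op Right ;; Query) M) (Pair Empty ?x) (bool_code b) T (?l ^ card J)"
  proof (cases js)
    case Nil
    then have "bool_code b = Empty" using F(2) card by simp
    then show ?thesis using runs_in_mono[OF runs_in_search_prog_empty, where Q'="?l ^ card J"] Nil by (metis zero_le)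
  next
    case (Cons j js')
    obtain L where L: "loop_free_value M (Pair Empty (Pair (vec_code es c) (set_code (j # js')))) = list_code L"
      "length L = ?l - 1" using M(3) card(1) Cons by (metis length_Cons)
    have "1 \<le> ?l" using len[of "card J"] card(1) Cons by simp
    from search_prog_decides_B_fam[OF inst(1,2) _ _ this product_search_oracle[OF inst(1) es] M(1,2) L]
    show ?thesis using F(1) card inst(3) Cons by auto
  qed
  then obtain T where T: "runs_in ?orc False (search_prog (Op Right ;; Query) M) (Pair Empty ?x) (bool_code b) T (?l ^ card J)" ..
  have "runs_in ?orc False (Fork empty_prog (Op Ident)) ?x (Pair Empty ?x) 0 0"
    by (rule runs_in_loop_free) simp_all
  from runs_in_Then[OF this T]
  show "\<exists>t q. exec ?orc (Fork empty_prog (Op Ident) ;; search_prog (Op Right ;; Query) M) ?x (bool_code b) t q \<and>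
      q \<le> ?l ^ card J"
    unfolding runs_in_def by auto
qed

text \<open>
  With \<open>l \<le> b (\<kappa> + 1)\<close> factors, the number of steps of the search is at most \<open>3\<close> to the power
  \<open>b (\<kappa> + 1)\<^sup>2\<close>, which depends on the parameter only.
\<close>

lemma fixed_parameter_tractable_search:
  fixes len :: "nat \<Rightarrow> nat"
  assumes R: "instance_class R" "polytime (optimization_problem R)"
    and M: "loop_free M" "arith_free M"
      "\<And>d obj j js. \<exists>L. loop_free_value M (Pair d (Pair obj (set_code (j # js)))) = list_code L \<and>
         length L = len (Suc (length js)) - 1"
    and len: "\<And>n. 1 \<le> n \<Longrightarrow> 1 \<le> len n \<and> len n \<le> b * (n + 1)"
    and F: "\<And>E K c \<alpha> J. cone_instance E K \<Longrightarrow> is_max (truncation E K) (dot E c) \<alpha> \<Longrightarrow> J \<subseteq> E \<Longrightarrow> J \<noteq> {} \<Longrightarrow>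
        J \<in> F E (truncation E K) c \<alpha> \<longleftrightarrow> J \<in> B_fam (len (card J)) E (truncation E K) c \<alpha>"
      "\<And>E K c \<alpha>. cone_instance E K \<Longrightarrow> is_max (truncation E K) (dot E c) \<alpha> \<Longrightarrow> \<alpha> > 0 \<Longrightarrow>
        {} \<notin> F E (truncation E K) c \<alpha>"
  shows "fixed_parameter_tractable (membership_problem R F)"
proof -
  obtain p C k where p: "\<And>x y. (x, y) \<in> optimization_problem R \<Longrightarrow> \<exists>t. runs p x y t \<and> t \<le> C * vsize x ^ k"
    using R(2) unfolding polytime_def by blast
  define S where "S = swap_prog ;; sum_prog (swap_prog ;; p)"
  obtain A m where A: "1 \<le> A" "\<And>N n. 1 \<le> N \<Longrightarrow> 1 \<le> n \<Longrightarrow>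
      search_time M (300000 + 20000 * C) (k + 3) N n \<le> A ^ N * n ^ m"
    using search_time_bound by blast
  \<comment> \<open>The summand 400 covers the immediate rejection of the empty set.\<close>
  define f where "f = (\<lambda>\<kappa>. (A + 400) ^ ((3 ^ b) ^ ((\<kappa> + 1) ^ 2)))"
  have f: "400 \<le> f \<kappa>" for \<kappa>
    using power_increasing[of 1 "(3 ^ b) ^ ((\<kappa> + 1) ^ 2)" "A + 400"] by (simp add: f_def)
  have "\<exists>t. runs (search_prog S M) x (bool_code ans) t \<and> t \<le> f \<kappa> * vsize x ^ (m + 1)"
    if mem: "(x, \<kappa>, ans) \<in> membership_problem R F" for x \<kappa> ans
  proof -
    obtain d E K es c js J \<alpha> where
      eq: "(x, \<kappa>, ans) = (Pair d (Pair (vec_code es c) (set_code js)), card J, J \<in> F E (truncation E K) c \<alpha>)"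
      and inst: "(d, E, K) \<in> R" "enumerates es E" "\<forall>e\<in>E. c e \<in> \<rat>"
      "enumerates js J" "J \<subseteq> E" "is_max (truncation E K) (dot E c) \<alpha>" "\<alpha> > 0"
      using mem unfolding membership_problem_def by blast
    have x: "x = Pair d (Pair (vec_code es c) (set_code js))" "\<kappa> = card J"
      "ans \<longleftrightarrow> J \<in> F E (truncation E K) c \<alpha>"
      using eq by simp_all
    let ?obj = "vec_code es c"
    have cone: "cone_instance E K" and d: "rational_data d" using R(1) inst(1) unfolding instance_class_def by auto
    have card: "card J = length js" "set js = J" "distinct js" using inst(4) distinct_card unfolding enumerates_def by auto
    have rat: "rational_data (Pair d ?obj)"
      using d inst(2,3) by (auto simp: vec_code_def rational_list_code enumerates_def)
    have n: "1 \<le> vsize x" by simp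
    have "runs_in (\<lambda>_ _. False) True (search_prog S M) x (bool_code ans) (f \<kappa> * vsize x ^ (m + 1)) (len \<kappa> ^ \<kappa>)"
    proof (cases js)
      case Nil
      then have "J = {}" using card by simp
      then have "bool_code ans = Empty" using F(2)[OF cone inst(6,7)] x(3) by simp
      moreover have "400 * vsize x \<le> f \<kappa> * vsize x ^ (m + 1)"
        using f power_increasing[of 1 "m + 1" "vsize x"] n by (intro mult_mono) auto
      ultimately show ?thesis using runs_in_search_prog_empty[of _ True S M d ?obj] Nil x(1)
        by (metis runs_in_mono zero_le)
    next
      case (Cons j js')
      let ?l = "len \<kappa>"
      let ?N = "(3::nat) ^ (length js' + Suc (length (j # js')) * (?l - 1))"
      have \<kappa>: "\<kappa> = Suc (length js')" using x(2) card(1) Cons by simp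
      have l: "1 \<le> ?l" "?l \<le> b * (\<kappa> + 1)" using len[of \<kappa>] \<kappa> by auto
      obtain L where L: "loop_free_value M (Pair d (Pair ?obj (set_code (j # js')))) = list_code L" "length L = ?l - 1"
        using M(3) \<kappa> by metis
      have "product_search (\<lambda>_ _. False) True S d ?obj (opt_value E K c) (j # js') ?l (300000 + 20000 * C) (k + 3)"
        unfolding S_def
      proof (rule product_search_solver[OF _ rat])
        fix B assume B: "distinct B" "set B \<subseteq> set (j # js')"
        then have "set B \<subseteq> E" using card inst(5) Cons by auto
        then have "(Pair d (Pair ?obj (set_code B)), Num (opt_value E K c (set B))) \<in> optimization_problem R"
          unfolding optimization_problem_def using inst B is_max_opt_value[OF cone] by blast
        then show "\<exists>t. runs p (Pair d (Pair ?obj (set_code B))) (Num (opt_value E K c (set B))) t \<and>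
          t \<le> C * vsize (Pair d (Pair ?obj (set_code B))) ^ k" by (rule p)
      qed (use card Cons in simp)
      then have "runs_in (\<lambda>_ _. False) True (search_prog S M) x (bool_code (J \<in> B_fam ?l E (truncation E K) c \<alpha>))
          (search_time M (300000 + 20000 * C) (k + 3) ?N (vsize x)) (?l ^ \<kappa>)"
        using search_prog_decides_B_fam[OF cone inst(6) _ _ l(1) _ M(1,2) L, of "\<lambda>_ _. False" True S] rat card inst(5) Cons x(1,2)
        by auto
      moreover have "J \<in> B_fam ?l E (truncation E K) c \<alpha> \<longleftrightarrow> ans"
        using F(1)[OF cone inst(6,5)] x(2,3) card Cons by auto
      moreover have "search_time M (300000 + 20000 * C) (k + 3) ?N (vsize x) \<le> f \<kappa> * vsize x ^ (m + 1)"
      proof -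
        have "length js' + Suc (length (j # js')) * (?l - 1) \<le> Suc \<kappa> * ?l"
          using l(1) \<kappa> by (cases ?l) simp_all
        also have "\<dots> \<le> Suc \<kappa> * (b * (\<kappa> + 1))" using l(2) by (rule mult_left_mono) simp
        finally have "?N \<le> 3 ^ (Suc \<kappa> * (b * (\<kappa> + 1)))" by (rule power_increasing) simp
        also have "Suc \<kappa> * (b * (\<kappa> + 1)) = b * (\<kappa> + 1) ^ 2" by (simp add: power2_eq_square algebra_simps)
        also have "(3::nat) ^ (b * (\<kappa> + 1) ^ 2) = (3 ^ b) ^ ((\<kappa> + 1) ^ 2)" by (rule power_mult)
        finally have N: "?N \<le> (3 ^ b) ^ ((\<kappa> + 1) ^ 2)" .
        have "search_time M (300000 + 20000 * C) (k + 3) ?N (vsize x) \<le> A ^ ?N * vsize x ^ m"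
          by (rule A(2)) (use n in auto)
        also have "\<dots> \<le> f \<kappa> * vsize x ^ (m + 1)"
        proof (rule mult_mono)
          have "A ^ ?N \<le> (A + 400) ^ ?N" by (rule power_mono) simp_all
          also have "\<dots> \<le> f \<kappa>" unfolding f_def by (rule power_increasing[OF N]) simp
          finally show "A ^ ?N \<le> f \<kappa>" .
        qed (use n in \<open>auto intro: power_increasing\<close>)
        finally show ?thesis .
      qed
      ultimately show ?thesis by (auto intro: runs_in_mono)
    qed
    then obtain t q where "exec (\<lambda>_ _. False) (search_prog S M) x (bool_code ans) t q" "t \<le> f \<kappa> * vsize x ^ (m + 1)"
      unfolding runs_in_def by auto
    then show ?thesis using exec_no_queries unfolding runs_def by blast
  qed
  moreover have "computable f" unfolding f_def by (rule computable_double_power)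
  ultimately show ?thesis unfolding fixed_parameter_tractable_def
    by (intro exI[of _ "search_prog S M"] exI[of _ f] exI[of _ "m + 1"]) auto
qed

primrec unary_prog :: "nat \<Rightarrow> prog" where
  "unary_prog 0 = empty_prog"
| "unary_prog (Suc n) = Fork empty_prog (unary_prog n)"

lemma unary_prog: "loop_free (unary_prog n)" "arith_free (unary_prog n)"
  "loop_free_value (unary_prog n) x = list_code (replicate n Empty)"
  by (induction n) simp_all

theorem proposition3p8:
  fixes R :: "(val \<times> nat set \<times> (nat \<Rightarrow> real) set) set"
  assumes "instance_class R"
    and "polytime (optimization_problem R)"
  shows
    "(\<forall>l\<ge>1.
        (\<exists>p. \<forall>E K c \<alpha> J.
           cone_instance E K \<and> is_max (truncation E K) (dot E c) \<alpha> \<and> \<alpha> > 0 \<and> J \<subseteq> E \<longrightarrow>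
           decides_with_lps p E K c J (J \<in> B_fam l E (truncation E K) c \<alpha>) l (l ^ card J)) \<and>
        fixed_parameter_tractable (membership_problem R (B_fam l))) \<and>
     (\<exists>p. \<forall>E K c \<alpha> J.
        cone_instance E K \<and> is_max (truncation E K) (dot E c) \<alpha> \<and> \<alpha> > 0 \<and> J \<subseteq> E \<longrightarrow>
        decides_with_lps p E K c J (J \<in> B_inf E (truncation E K) c \<alpha>) (card J) (card J ^ card J)) \<and>
     fixed_parameter_tractable (membership_problem R B_inf)"
proof (intro conjI allI impI)
  fix l :: nat assume l: "1 \<le> l"
  have M: "\<exists>L. loop_free_value (unary_prog (l - 1)) (Pair d (Pair obj (set_code (j # js)))) = list_code L \<and>
      length L = l - 1" for d obj j js
    by (rule exI[of _ "replicate (l - 1) Empty"]) (simp add: unary_prog)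
  show "\<exists>p. \<forall>E K c \<alpha> J.
      cone_instance E K \<and> is_max (truncation E K) (dot E c) \<alpha> \<and> \<alpha> > 0 \<and> J \<subseteq> E \<longrightarrow>
      decides_with_lps p E K c J (J \<in> B_fam l E (truncation E K) c \<alpha>) l (l ^ card J)"
  proof (intro exI allI impI, elim conjE)
    fix E K c \<alpha> J
    assume inst: "cone_instance E K" "is_max (truncation E K) (dot E c) \<alpha>" "\<alpha> > 0" "J \<subseteq> E"
    show "decides_with_lps (Fork empty_prog (Op Ident) ;; search_prog (Op Right ;; Query) (unary_prog (l - 1)))
        E K c J (J \<in> B_fam l E (truncation E K) c \<alpha>) l (l ^ card J)"
      by (rule decides_with_lps_search_prog[where len="\<lambda>_. l", OF unary_prog(1,2) M])
        (use l inst empty_notin_B_fam in auto)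
  qed
  show "fixed_parameter_tractable (membership_problem R (B_fam l))"
    by (rule fixed_parameter_tractable_search[where len="\<lambda>_. l" and b=l, OF assms unary_prog(1,2) M])
      (use l empty_notin_B_fam in auto)
next
  \<comment> \<open>The tail of the list \<open>J\<close> itself has length \<open>l - 1\<close> for \<open>l = |J|\<close>.\<close>
  let ?M = "path [Right, Right, Right]"
  have M: "\<exists>L. loop_free_value ?M (Pair d (Pair obj (set_code (j # js)))) = list_code L \<and>
      length L = Suc (length js) - 1" for d obj j js
    by (rule exI[of _ "map (\<lambda>e. Num (real e)) js"]) (simp add: set_code_def)
  have free: "loop_free ?M" "arith_free ?M" by simp_all
  have empty: "{} \<notin> B_inf E (truncation E K) c \<alpha>"
    if "cone_instance E K" "is_max (truncation E K) (dot E c) \<alpha>" "\<alpha> > 0" for E K c \<alpha>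
    using empty_notin_B_fam[OF that, of 1] unfolding B_inf_def by auto
  show "\<exists>p. \<forall>E K c \<alpha> J.
      cone_instance E K \<and> is_max (truncation E K) (dot E c) \<alpha> \<and> \<alpha> > 0 \<and> J \<subseteq> E \<longrightarrow>
      decides_with_lps p E K c J (J \<in> B_inf E (truncation E K) c \<alpha>) (card J) (card J ^ card J)"
  proof (intro exI allI impI, elim conjE)
    fix E K c \<alpha> J
    assume inst: "cone_instance E K" "is_max (truncation E K) (dot E c) \<alpha>" "\<alpha> > 0" "J \<subseteq> E"
    show "decides_with_lps (Fork empty_prog (Op Ident) ;; search_prog (Op Right ;; Query) ?M)
        E K c J (J \<in> B_inf E (truncation E K) c \<alpha>) (card J) (card J ^ card J)"
      by (rule decides_with_lps_search_prog[where len="\<lambda>n. n", OF free M])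
        (use inst empty B_inf_iff_B_fam_card in auto)
  qed
  show "fixed_parameter_tractable (membership_problem R B_inf)"
    by (rule fixed_parameter_tractable_search[where len="\<lambda>n. n" and b=1, OF assms free M])
      (use empty B_inf_iff_B_fam_card in auto)
qed

end
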